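(* Let $\mathcal{A}$ be a nonzero nonnegative combinatorially symmetric tensor of order $m$ and dimension $n$, with spectral radius $\rho(\mathcal{A})$. Then the projective eigenvariety $\mathbb{V}_{\rho(\mathcal{A})}(\mathcal{A})$ has dimension greater than zero if and only if $\mathcal{A}$ has at least two weakly irreducible components with spectral radius equal to $\rho(\mathcal{A})$.
   Context: Let $m\ge 2$, $n\ge 1$, $[n]=\{1,\dots,n\}$. A tensor of order $m$ and dimension $n$ is an array $\mathcal{A}=(a_{i_1i_2\ldots i_m})$ of complex numbers indexed by $i_1,\dots,i_m\in[n]$; it is nonnegative if all its entries are nonnegative reals. For $\mathbf{x}\in\mathbb{C}^n$, $\mathcal{A}\mathbf{x}^{m-1}\in\mathbb{C}^n$ is defined by $(\mathcal{A}\mathbf{x}^{m-1})_i=\sum_{i_2,\dots,i_m\in[n]}a_{ii_2\cdots i_m}x_{i_2}\cdots x_{i_m}$, and $\mathbf{x}^{[m-1]}=(x_1^{m-1},\dots,x_n^{m-1})$. A number $\lambda\in\mathbb{C}$ is an eigenvalue of $\mathcal{A}$ if $\mathcal{A}\mathbf{x}^{m-1}=\lambda\mathbf{x}^{[m-1]}$ for some nonzero $\mathbf{x}\in\mathbb{C}^n$. The spectral radius $\rho(\mathcal{A})$ is the largest modulus of an eigenvalue of $\mathcal{A}$ (for a nonnegative tensor, $\rho(\mathcal{A})$ is itself an eigenvalue). The projective eigenvariety associated with an eigenvalue $\lambda$ is $\mathbb{V}_\lambda(\mathcal{A})=\{\mathbf{x}\in\mathbb{P}^{n-1}:\mathcal{A}\mathbf{x}^{m-1}=\lambda\mathbf{x}^{[m-1]}\}$,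 where $\mathbb{P}^{n-1}$ is complex projective space. The dimension of a variety is its dimension as a Zariski topological space. The tensor $\mathcal{A}$ is combinatorially symmetric if its support is symmetric, i.e. whether $a_{i_1\ldots i_m}\neq 0$ is invariant under all permutations of the indices $i_1,\dots,i_m$. The directed graph $G(\mathcal{A})$ has vertex set $[n]$, and $(i,j)$ is an arc if and only if there is a nonzero entry $a_{ii_2\ldots i_m}$ with $j\in\{i_2,\dots,i_m\}$. A tensor is weakly irreducible if its directed graph is strongly connected. Let $\alpha_1,\dots,\alpha_s$ be the vertex sets of the strongly connected components of $G(\mathcal{A})$. For $\alpha\subseteq[n]$, the principal subtensor $\mathcal{A}[\alpha]$ is the tensor of order $m$ and dimension $|\alpha|$ with entries $a_{i_1\ldots i_m}$, $i_1,\dots,i_m\in\alpha$. When $\mathcal{A}$ is combinatorially symmetric, $G(\mathcal{A})$ is undirected (arcs come in both directions), $\mathcal{A}$ is the direct sum of the $\mathcal{A}[\alpha_i]$, and each $\mathcal{A}[\alpha_i]$ is either weakly irreducible or a zero tensor of dimension one; each nonzero $\mathcal{A}[\alpha_i]$ is called a weakly irreducible component of $\mathcal{A}$. *)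

theory Defs
  imports
    "HOL-Analysis.Analysis"
    "HOL-Library.Poly_Mapping"
    "Graph_Theory.Digraph_Component"
begin

section \<open>Tensors\<close>

text \<open>
  A tensor of order \<open>m\<close> over a finite index set \<open>I\<close> (so, of dimension \<open>card I\<close>) is a function on
  index lists, of which only the values on \<open>indices m I\<close> matter. All notions take \<open>m\<close> and \<open>I\<close> as
  parameters and only look at these values. In particular, the principal subtensor of \<open>A\<close> on
  \<open>\<alpha> \<subseteq> I\<close> is the same function \<open>A\<close>, considered over the index set \<open>\<alpha>\<close> instead of \<open>I\<close>.
\<close>

type_synonym 'i tensor = "'i list \<Rightarrow> complex"

definition indices :: "nat \<Rightarrow> 'i set \<Rightarrow> 'i list set" where
  "indices m I = {is. set is \<subseteq> I \<and> length is = m}"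

definition nonzero_tensor :: "nat \<Rightarrow> 'i set \<Rightarrow> 'i tensor \<Rightarrow> bool" where
  "nonzero_tensor m I A \<longleftrightarrow> (\<exists>is\<in>indices m I. A is \<noteq> 0)"

definition nonneg_tensor :: "nat \<Rightarrow> 'i set \<Rightarrow> 'i tensor \<Rightarrow> bool" where
  "nonneg_tensor m I A \<longleftrightarrow> (\<forall>is\<in>indices m I. A is \<in> \<real>\<^sub>\<ge>\<^sub>0)"

definition comb_symmetric :: "nat \<Rightarrow> 'i set \<Rightarrow> 'i tensor \<Rightarrow> bool" where
  "comb_symmetric m I A \<longleftrightarrow>
     (\<forall>is\<in>indices m I. \<forall>js\<in>indices m I. mset is = mset js \<longrightarrow> (A is \<noteq> 0 \<longleftrightarrow> A js \<noteq> 0))"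


section \<open>Eigenvalues and spectral radius\<close>

text \<open>The vector space \<open>\<complex>\<^sup>I\<close>, as the functions that vanish outside \<open>I\<close>.\<close>

definition cvec :: "'i set \<Rightarrow> ('i \<Rightarrow> complex) set" where
  "cvec I = {x. \<forall>i. i \<notin> I \<longrightarrow> x i = 0}"

text \<open>The \<open>i\<close>-th entry of the vector \<open>A x\<^sup>m\<^sup>-\<^sup>1\<close>.\<close>

definition tensor_apply :: "nat \<Rightarrow> 'i set \<Rightarrow> 'i tensor \<Rightarrow> ('i \<Rightarrow> complex) \<Rightarrow> 'i \<Rightarrow> complex" where
  "tensor_apply m I A x i = (\<Sum>js\<in>indices (m - 1) I. A (i # js) * prod_list (map x js))"

definition eigen_equation :: "nat \<Rightarrow> 'i set \<Rightarrow> 'i tensor \<Rightarrow> complex \<Rightarrow> ('i \<Rightarrow> complex) \<Rightarrow> bool" where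
  "eigen_equation m I A \<mu> x \<longleftrightarrow> (\<forall>i\<in>I. tensor_apply m I A x i = \<mu> * x i ^ (m - 1))"

definition tensor_eigenvalue :: "nat \<Rightarrow> 'i set \<Rightarrow> 'i tensor \<Rightarrow> complex \<Rightarrow> bool" where
  "tensor_eigenvalue m I A \<mu> \<longleftrightarrow> (\<exists>x\<in>cvec I. x \<noteq> (\<lambda>_. 0) \<and> eigen_equation m I A \<mu> x)"

definition tensor_spectral_radius :: "nat \<Rightarrow> 'i set \<Rightarrow> 'i tensor \<Rightarrow> real" where
  "tensor_spectral_radius m I A = (GREATEST r. \<exists>\<mu>. tensor_eigenvalue m I A \<mu> \<and> r = cmod \<mu>)"


section \<open>Weakly irreducible components\<close>

definition tensor_digraph :: "nat \<Rightarrow> 'i set \<Rightarrow> 'i tensor \<Rightarrow> ('i, 'i \<times> 'i) pre_digraph" where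
  "tensor_digraph m I A =
     \<lparr> verts = I,
       arcs = {(i, j). i \<in> I \<and> (\<exists>js\<in>indices (m - 1) I. A (i # js) \<noteq> 0 \<and> j \<in> set js)},
       tail = fst, head = snd \<rparr>"

text \<open>
  A component is represented by its index set \<open>\<alpha>\<close>, the vertex set of a strongly connected component
  of the digraph. One-element components with zero subtensor are excluded.
\<close>

definition weakly_irreducible_components :: "nat \<Rightarrow> 'i set \<Rightarrow> 'i tensor \<Rightarrow> 'i set set" where
  "weakly_irreducible_components m I A =
     {\<alpha> \<in> pre_digraph.sccs_verts (tensor_digraph m I A). nonzero_tensor m \<alpha> A}"


section \<open>Homogeneous polynomials\<close>

text \<open>
  A polynomial maps exponents, which are finitely supported functions from variables to
  naturals, to coefficients.
\<close>

type_synonym 'i cpoly = "('i \<Rightarrow>\<^sub>0 nat) \<Rightarrow>\<^sub>0 complex"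

definition monom_eval :: "('i \<Rightarrow>\<^sub>0 nat) \<Rightarrow> ('i \<Rightarrow> complex) \<Rightarrow> complex" where
  "monom_eval e x = (\<Prod>i\<in>Poly_Mapping.keys e. x i ^ Poly_Mapping.lookup e i)"

definition cpoly_eval :: "'i cpoly \<Rightarrow> ('i \<Rightarrow> complex) \<Rightarrow> complex" where
  "cpoly_eval f x = (\<Sum>e\<in>Poly_Mapping.keys f. Poly_Mapping.lookup f e * monom_eval e x)"

definition homogeneous :: "'i set \<Rightarrow> nat \<Rightarrow> 'i cpoly \<Rightarrow> bool" where
  "homogeneous I d f \<longleftrightarrow>
     (\<forall>e\<in>Poly_Mapping.keys f. Poly_Mapping.keys e \<subseteq> I \<and>
        (\<Sum>i\<in>Poly_Mapping.keys e. Poly_Mapping.lookup e i) = d)"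

lemma monom_eval_superset:
  "finite S \<Longrightarrow> Poly_Mapping.keys e \<subseteq> S \<Longrightarrow>
    monom_eval e x = (\<Prod>i\<in>S. x i ^ Poly_Mapping.lookup e i)"
  unfolding monom_eval_def by (rule prod.mono_neutral_left) (auto simp: in_keys_iff)

lemma monom_eval_add: "monom_eval (a + b) x = monom_eval a x * monom_eval b x"
proof -
  let ?S = "Poly_Mapping.keys a \<union> Poly_Mapping.keys b"
  have "Poly_Mapping.keys (a + b) \<subseteq> ?S" by (rule keys_add)
  then show ?thesis
    by (simp add: monom_eval_superset[of ?S] lookup_add power_add prod.distrib)
qed

lemma cpoly_eval_zero [simp]: "cpoly_eval 0 x = 0"
  by (simp add: cpoly_eval_def)

lemma cpoly_eval_add: "cpoly_eval (f + g) x = cpoly_eval f x + cpoly_eval g x"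
  unfolding cpoly_eval_def
  by (rule setsum_keys_plus_distrib) (auto simp: algebra_simps)

lemma cpoly_eval_sum: "cpoly_eval (\<Sum>k\<in>S. f k) x = (\<Sum>k\<in>S. cpoly_eval (f k) x)"
  by (induction S rule: infinite_finite_induct) (auto simp: cpoly_eval_add)

lemma cpoly_eval_single: "cpoly_eval (Poly_Mapping.single e c) x = c * monom_eval e x"
  by (simp add: cpoly_eval_def)

lemma cpoly_as_sum:
  "(f :: 'i cpoly) = (\<Sum>e\<in>Poly_Mapping.keys f. Poly_Mapping.single e (Poly_Mapping.lookup f e))"
  by (rule poly_mapping_eqI)
    (auto simp: lookup_sum lookup_single when_def in_keys_iff sum.delta)

lemma cpoly_eval_mult: "cpoly_eval (f * g) x = cpoly_eval f x * cpoly_eval g x"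
proof -
  have "f * g = (\<Sum>a\<in>Poly_Mapping.keys f. \<Sum>b\<in>Poly_Mapping.keys g.
      Poly_Mapping.single (a + b) (Poly_Mapping.lookup f a * Poly_Mapping.lookup g b))"
    unfolding mult_single[symmetric] sum_product[symmetric] cpoly_as_sum[symmetric] ..
  then have "cpoly_eval (f * g) x =
      (\<Sum>a\<in>Poly_Mapping.keys f. \<Sum>b\<in>Poly_Mapping.keys g.
        Poly_Mapping.lookup f a * Poly_Mapping.lookup g b * monom_eval (a + b) x)"
    by (simp add: cpoly_eval_sum cpoly_eval_single)
  also have "\<dots> = cpoly_eval f x * cpoly_eval g x"
    by (simp add: cpoly_eval_def sum_product monom_eval_add mult_ac)
  finally show ?thesis .
qed

lemma cpoly_eval_scale:
  assumes "homogeneous I d f"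
  shows "cpoly_eval f (\<lambda>i. c * x i) = c ^ d * cpoly_eval f x"
proof -
  have "monom_eval e (\<lambda>i. c * x i) = c ^ d * monom_eval e x" if "e \<in> Poly_Mapping.keys f" for e
  proof -
    have "(\<Sum>i\<in>Poly_Mapping.keys e. Poly_Mapping.lookup e i) = d"
      using assms that by (auto simp: homogeneous_def)
    then show ?thesis
      by (simp add: monom_eval_def power_mult_distrib prod.distrib flip: power_sum)
  qed
  then show ?thesis
    by (simp add: cpoly_eval_def sum_distrib_left mult_ac)
qed

lemma homogeneous_mult:
  assumes "homogeneous I d f" "homogeneous I e g"
  shows "homogeneous I (d + e) (f * g)"
  unfolding homogeneous_def
proof
  fix k assume "k \<in> Poly_Mapping.keys (f * g)"
  then obtain a b where k: "k = a + b" and ab: "a \<in> Poly_Mapping.keys f" "b \<in> Poly_Mapping.keys g"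
    using keys_mult[of f g] by auto
  have a: "Poly_Mapping.keys a \<subseteq> I" "(\<Sum>i\<in>Poly_Mapping.keys a. Poly_Mapping.lookup a i) = d"
    and b: "Poly_Mapping.keys b \<subseteq> I" "(\<Sum>i\<in>Poly_Mapping.keys b. Poly_Mapping.lookup b i) = e"
    using assms ab by (auto simp: homogeneous_def)
  have "(\<Sum>i\<in>Poly_Mapping.keys k. Poly_Mapping.lookup k i) =
      (\<Sum>i\<in>Poly_Mapping.keys a. Poly_Mapping.lookup a i) +
      (\<Sum>i\<in>Poly_Mapping.keys b. Poly_Mapping.lookup b i)"
    unfolding k by (rule setsum_keys_plus_distrib) auto
  moreover have "Poly_Mapping.keys k \<subseteq> I"
    using a(1) b(1) keys_add[of a b] unfolding k by blast
  ultimately show "Poly_Mapping.keys k \<subseteq> I \<and> (\<Sum>i\<in>Poly_Mapping.keys k. Poly_Mapping.lookup k i) = d + e"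
    using a(2) b(2) by simp
qed


section \<open>Projective space with its Zariski topology\<close>

definition proj_rel :: "'i set \<Rightarrow> (('i \<Rightarrow> complex) \<times> ('i \<Rightarrow> complex)) set" where
  "proj_rel I = {(x, y). x \<in> cvec I - {\<lambda>_. 0} \<and> y \<in> cvec I - {\<lambda>_. 0} \<and>
                         (\<exists>c. c \<noteq> 0 \<and> y = (\<lambda>i. c * x i))}"

definition proj_space :: "'i set \<Rightarrow> ('i \<Rightarrow> complex) set set" where
  "proj_space I = (cvec I - {\<lambda>_. 0}) // proj_rel I"

definition zero_locus :: "'i set \<Rightarrow> 'i cpoly set \<Rightarrow> ('i \<Rightarrow> complex) set set" where
  "zero_locus I S = {P \<in> proj_space I. \<forall>x\<in>P. \<forall>f\<in>S. cpoly_eval f x = 0}"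

definition zariski_closed :: "'i set \<Rightarrow> ('i \<Rightarrow> complex) set set \<Rightarrow> bool" where
  "zariski_closed I Z \<longleftrightarrow> (\<exists>S. (\<forall>f\<in>S. \<exists>d. homogeneous I d f) \<and> Z = zero_locus I S)"

definition zariski :: "'i set \<Rightarrow> ('i \<Rightarrow> complex) set topology" where
  "zariski I = topology (\<lambda>U. U \<subseteq> proj_space I \<and> zariski_closed I (proj_space I - U))"

lemma equiv_proj_rel: "equiv (cvec I - {\<lambda>_. 0}) (proj_rel I)"
proof (rule equivI)
  show "refl_on (cvec I - {\<lambda>_. 0}) (proj_rel I)"
    by (rule refl_onI) (auto simp: proj_rel_def intro!: exI[of _ 1])
  show "sym (proj_rel I)"
  proof (rule symI)
    fix x y assume "(x, y) \<in> proj_rel I"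
    then show "(y, x) \<in> proj_rel I"
      unfolding proj_rel_def
      by clarsimp (rule_tac x = "inverse c" in exI, auto simp: fun_eq_iff)
  qed
  show "trans (proj_rel I)"
  proof (rule transI)
    fix x y z assume "(x, y) \<in> proj_rel I" "(y, z) \<in> proj_rel I"
    then show "(x, z) \<in> proj_rel I"
      unfolding proj_rel_def
      by clarsimp (rule_tac x = "ca * c" in exI, auto)
  qed
qed (auto simp: proj_rel_def)

lemma proj_point_scale:
  assumes "P \<in> proj_space I" "x \<in> P" "y \<in> P"
  obtains c where "c \<noteq> 0" "y = (\<lambda>i. c * x i)"
proof -
  have "(x, y) \<in> proj_rel I"
    using assms quotient_eq_iff[OF equiv_proj_rel] unfolding proj_space_def by metis
  then show thesis
    using that by (auto simp: proj_rel_def)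
qed

lemma proj_point_nonempty: "P \<in> proj_space I \<Longrightarrow> P \<noteq> {}"
  unfolding proj_space_def by (rule in_quotient_imp_non_empty[OF equiv_proj_rel])

lemma zariski_closed_Un:
  assumes "zariski_closed I Y" "zariski_closed I Z"
  shows "zariski_closed I (Y \<union> Z)"
proof -
  obtain S T where S: "\<forall>f\<in>S. \<exists>d. homogeneous I d f" "Y = zero_locus I S"
    and T: "\<forall>f\<in>T. \<exists>d. homogeneous I d f" "Z = zero_locus I T"
    using assms unfolding zariski_closed_def by blast
  let ?ST = "{f * g | f g. f \<in> S \<and> g \<in> T}"
  have "zero_locus I ?ST \<subseteq> Y \<union> Z"
  proof
    fix P assume P: "P \<in> zero_locus I ?ST"
    then have PI: "P \<in> proj_space I" by (simp add: zero_locus_def)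
    show "P \<in> Y \<union> Z"
    proof (rule ccontr)
      assume "P \<notin> Y \<union> Z"
      then obtain x f y g where x: "x \<in> P" "f \<in> S" "cpoly_eval f x \<noteq> 0"
        and y: "y \<in> P" "g \<in> T" "cpoly_eval g y \<noteq> 0"
        using PI S(2) T(2) unfolding zero_locus_def by blast
      obtain c where c: "c \<noteq> 0" "y = (\<lambda>i. c * x i)"
        using proj_point_scale[OF PI x(1) y(1)] .
      obtain d where "homogeneous I d g" using T(1) y(2) by blast
      then have "cpoly_eval g x \<noteq> 0"
        using y(3) by (auto simp: c(2) cpoly_eval_scale)
      moreover have "cpoly_eval (f * g) x = 0"
        using P x(1,2) y(2) unfolding zero_locus_def by blast
      ultimately show False using x(3) by (simp add: cpoly_eval_mult)
    qed
  qed
  moreover have "Y \<union> Z \<subseteq> zero_locus I ?ST"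
    by (auto simp: S(2) T(2) zero_locus_def cpoly_eval_mult)
  moreover have "\<forall>f\<in>?ST. \<exists>d. homogeneous I d f"
    using S(1) T(1) homogeneous_mult by blast
  ultimately show ?thesis unfolding zariski_closed_def by blast
qed

lemma zariski_closed_Inter:
  assumes "\<forall>Z\<in>\<Z>. zariski_closed I Z"
  shows "zariski_closed I (proj_space I \<inter> \<Inter>\<Z>)"
proof -
  obtain S where S: "\<And>Z. Z \<in> \<Z> \<Longrightarrow> (\<forall>f\<in>S Z. \<exists>d. homogeneous I d f) \<and> Z = zero_locus I (S Z)"
    using assms unfolding zariski_closed_def by metis
  have "proj_space I \<inter> \<Inter>\<Z> = zero_locus I (\<Union>(S ` \<Z>))" (is "?L = ?R")
  proof
    show "?L \<subseteq> ?R" using S unfolding zero_locus_def by blast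
    show "?R \<subseteq> ?L"
    proof
      fix P assume P: "P \<in> ?R"
      have "P \<in> Z" if Z: "Z \<in> \<Z>" for Z
      proof -
        have "P \<in> zero_locus I (S Z)" using P Z by (auto simp: zero_locus_def)
        then show ?thesis using S[OF Z] by simp
      qed
      then show "P \<in> ?L" using P by (auto simp: zero_locus_def)
    qed
  qed
  moreover have "\<forall>f\<in>\<Union>(S ` \<Z>). \<exists>d. homogeneous I d f" using S by auto
  ultimately show ?thesis unfolding zariski_closed_def by (intro exI conjI)
qed

lemma istopology_zariski:
  "istopology (\<lambda>U. U \<subseteq> proj_space I \<and> zariski_closed I (proj_space I - U))"
  unfolding istopology_def
proof (intro conjI allI impI)
  fix U V :: "('a \<Rightarrow> complex) set set"
  assume UV: "U \<subseteq> proj_space I \<and> zariski_closed I (proj_space I - U)"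
    "V \<subseteq> proj_space I \<and> zariski_closed I (proj_space I - V)"
  then show "U \<inter> V \<subseteq> proj_space I" by blast
  show "zariski_closed I (proj_space I - U \<inter> V)"
    using UV by (simp add: Diff_Int zariski_closed_Un)
next
  fix \<U> :: "('a \<Rightarrow> complex) set set set"
  assume U: "\<forall>U\<in>\<U>. U \<subseteq> proj_space I \<and> zariski_closed I (proj_space I - U)"
  then show "\<Union>\<U> \<subseteq> proj_space I" by blast
  have "proj_space I - \<Union>\<U> = proj_space I \<inter> \<Inter>((\<lambda>U. proj_space I - U) ` \<U>)"
    by blast
  moreover have "zariski_closed I (proj_space I \<inter> \<Inter>((\<lambda>U. proj_space I - U) ` \<U>))"
    by (rule zariski_closed_Inter) (use U in auto)
  ultimately show "zariski_closed I (proj_space I - \<Union>\<U>)" by (rule ssubst)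
qed

lemma zariski_closed_proj_space: "zariski_closed I (proj_space I)"
  unfolding zariski_closed_def by (rule exI[of _ "{}"]) (simp add: zero_locus_def)

lemma zariski_closed_empty: "zariski_closed I {}"
proof -
  have "zero_locus I {1} = {}"
    using proj_point_nonempty by (fastforce simp: zero_locus_def cpoly_eval_def monom_eval_def)
  moreover have "homogeneous I 0 1" by (simp add: homogeneous_def)
  ultimately show ?thesis unfolding zariski_closed_def by blast
qed

lemma openin_zariski:
  "openin (zariski I) U \<longleftrightarrow> U \<subseteq> proj_space I \<and> zariski_closed I (proj_space I - U)"
  unfolding zariski_def by (simp add: topology_inverse' istopology_zariski)

lemma topspace_zariski [simp]: "topspace (zariski I) = proj_space I"
proof
  show "topspace (zariski I) \<subseteq> proj_space I"
    unfolding topspace_def by (auto simp: openin_zariski)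
  have "openin (zariski I) (proj_space I)"
    by (simp add: openin_zariski zariski_closed_empty)
  then show "proj_space I \<subseteq> topspace (zariski I)"
    by (rule openin_subset)
qed

lemma closedin_zariski: "closedin (zariski I) Z \<longleftrightarrow> zariski_closed I Z"
proof -
  have "Z \<subseteq> proj_space I" if "zariski_closed I Z"
    using that unfolding zariski_closed_def zero_locus_def by blast
  then show ?thesis
    by (auto simp: closedin_def openin_zariski double_diff)
qed


section \<open>Dimension of a topological space\<close>

definition irreducible_in :: "'a topology \<Rightarrow> 'a set \<Rightarrow> bool" where
  "irreducible_in X Z \<longleftrightarrow> Z \<subseteq> topspace X \<and> Z \<noteq> {} \<and>
     (\<forall>C D. closedin X C \<and> closedin X D \<and> Z \<subseteq> C \<union> D \<longrightarrow> Z \<subseteq> C \<or> Z \<subseteq> D)"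

text \<open>
  The supremum of the lengths \<open>k\<close> of chains \<open>Z 0 \<subset> Z 1 \<subset> \<dots> \<subset> Z k\<close> of irreducible closed sets.
  The empty space has dimension \<open>-\<infinity>\<close>.
\<close>

definition krull_dim :: "'a topology \<Rightarrow> ereal" where
  "krull_dim X = Sup {ereal (real k) | k. \<exists>Z.
     (\<forall>i\<le>k. closedin X (Z i) \<and> irreducible_in X (Z i)) \<and> (\<forall>i<k. Z i \<subset> Z (Suc i))}"


section \<open>Projective eigenvarieties\<close>

definition eigenvariety :: "nat \<Rightarrow> 'i set \<Rightarrow> 'i tensor \<Rightarrow> complex \<Rightarrow> ('i \<Rightarrow> complex) set set" where
  "eigenvariety m I A \<mu> = {P \<in> proj_space I. \<forall>x\<in>P. eigen_equation m I A \<mu> x}"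

definition eigenvariety_dim :: "nat \<Rightarrow> 'i set \<Rightarrow> 'i tensor \<Rightarrow> complex \<Rightarrow> ereal" where
  "eigenvariety_dim m I A \<mu> = krull_dim (subtopology (zariski I) (eigenvariety m I A \<mu>))"

end

theory Submission
  imports Defs
begin

text \<open>
  Write \<open>\<rho>\<close> for the spectral radius of \<open>A\<close>. Support symmetry makes every arc of the digraph two-way,
  so a nonzero entry has all its indices in one strongly connected component, and \<open>A\<close> is the direct
  sum of its subtensors on the components. Hence a vector satisfies the eigenvalue equation if and
  only if its restriction to every component does (\<open>eigen_equation_blocks\<close>), and \<open>\<rho>\<close> is the largest
  of the spectral radii of the components (\<open>spectral_radius_eq_Max\<close>).

  On one component a Perron--Frobenius theorem holds. There is a positive eigenvector \<open>y\<close> whose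
  eigenvalue \<open>r\<close> is the spectral radius (\<open>perron_vector_exists\<close>), and every eigenvector \<open>x\<close> whose
  eigenvalue has modulus \<open>r\<close> has entries of modulus \<open>t * y i\<close>, for one \<open>t\<close>
  (\<open>eigenvector_comparison\<close>). If the eigenvalue is \<open>r\<close> itself, the triangle inequality in the
  eigenvalue equation is an equality, so for every nonzero entry of \<open>A\<close> the product of
  \<open>x k / y k\<close> over its \<open>m\<close> indices is \<open>(x i / y i) ^ m\<close>, where \<open>i\<close> is its first index. By support
  symmetry each index of the entry can be made the first, so \<open>(x i / y i) ^ m\<close> is constant on the
  component (\<open>phase_power_constant\<close>). Up to a scalar, the quotients are therefore
  \<open>m\<close>-th roots of unity, and \<open>x\<close> is one of finitely many projective points.

  If only one component has spectral radius \<open>\<rho>\<close>, an eigenvector for \<open>\<rho>\<close> vanishes on all the others,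
  so the eigenvariety is finite (\<open>finite_eigenvariety\<close>); as points are closed, its dimension is not
  positive. If two components have spectral radius \<open>\<rho>\<close>, their Perron vectors \<open>u\<close> and \<open>v\<close>, extended by
  zero, have disjoint supports in different summands, so all \<open>u + t * v\<close> are eigenvectors. They form
  an irreducible subset with more than one point (\<open>line_irreducible\<close>), and the dimension is
  positive.
\<close>

section \<open>Nonnegative tensors acting on real vectors\<close>

text \<open>
  The entry of \<open>A x\<^sup>m\<^sup>-\<^sup>1\<close> for a nonnegative tensor and a real vector. The Perron--Frobenius
  argument needs the order of the reals; complex eigenvectors enter through their moduli.
\<close>
definition real_apply :: "nat \<Rightarrow> 'i set \<Rightarrow> 'i tensor \<Rightarrow> ('i \<Rightarrow> real) \<Rightarrow> 'i \<Rightarrow> real" where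
  "real_apply m I A x i = (\<Sum>js\<in>indices (m - 1) I. Re (A (i # js)) * prod_list (map x js))"

lemma finite_indices: "finite I \<Longrightarrow> finite (indices m I)"
  unfolding indices_def by (rule finite_lists_length_eq)

lemma indicesD: "js \<in> indices k I \<Longrightarrow> j \<in> set js \<Longrightarrow> j \<in> I"
  by (auto simp: indices_def)

lemma prod_list_nonneg:
  fixes f :: "'a \<Rightarrow> real"
  assumes "\<And>k. k \<in> set js \<Longrightarrow> 0 \<le> f k"
  shows "0 \<le> prod_list (map f js)"
  using assms by (induction js) auto

lemma prod_list_pos:
  fixes f :: "'a \<Rightarrow> real"
  assumes "\<And>k. k \<in> set js \<Longrightarrow> 0 < f k"
  shows "0 < prod_list (map f js)"
  using assms by (induction js) auto

lemma prod_list_mono: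
  fixes f g :: "'a \<Rightarrow> real"
  assumes "\<And>k. k \<in> set js \<Longrightarrow> 0 \<le> f k \<and> f k \<le> g k"
  shows "prod_list (map f js) \<le> prod_list (map g js)"
  using assms
proof (induction js)
  case (Cons k js)
  then have "0 \<le> prod_list (map f js)" by (intro prod_list_nonneg) auto
  then show ?case using Cons by (auto intro!: mult_mono intro: order_trans)
qed simp

lemma prod_list_strict_mono:
  fixes f g :: "'a \<Rightarrow> real"
  assumes "\<And>k. k \<in> set js \<Longrightarrow> 0 \<le> f k \<and> f k \<le> g k \<and> 0 < g k"
    and "j \<in> set js" "f j < g j"
  shows "prod_list (map f js) < prod_list (map g js)"
  using assms
proof (induction js)
  case (Cons k js)
  have g: "0 < prod_list (map g js)"
    using Cons.prems(1) by (intro prod_list_pos) auto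
  have f: "0 \<le> prod_list (map f js)"
    using Cons.prems(1) by (intro prod_list_nonneg) auto
  have le: "prod_list (map f js) \<le> prod_list (map g js)"
    using Cons.prems(1) by (intro prod_list_mono) auto
  have k: "0 \<le> f k" "f k \<le> g k" using Cons.prems(1) by auto
  show ?case
  proof (cases "f k < g k")
    case True
    have "f k * prod_list (map f js) \<le> f k * prod_list (map g js)"
      using le k(1) by (rule mult_left_mono)
    also have "\<dots> < g k * prod_list (map g js)" using True g by simp
    finally show ?thesis by simp
  next
    case False
    then have eq: "f k = g k" using k by simp
    then have "j \<in> set js" using Cons.prems by auto
    then have "prod_list (map f js) < prod_list (map g js)"
      using Cons by auto
    then show ?thesis using eq Cons.prems(1) by simp
  qed
qed simp

lemma prod_list_scale:
  fixes c :: "'a :: comm_semiring_1"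
  shows "prod_list (map (\<lambda>j. c * x j) js) = c ^ length js * prod_list (map x js)"
  by (induction js) (auto simp: algebra_simps)

lemma real_apply_scale: "real_apply m I A (\<lambda>j. c * x j) i = c ^ (m - 1) * real_apply m I A x i"
  unfolding real_apply_def sum_distrib_left
  by (rule sum.cong) (auto simp: prod_list_scale indices_def algebra_simps)

lemma nonneg_entry:
  assumes "nonneg_tensor m I A" "2 \<le> m" "i \<in> I" "js \<in> indices (m - 1) I"
  shows "A (i # js) = complex_of_real (Re (A (i # js)))" "0 \<le> Re (A (i # js))"
proof -
  have "i # js \<in> indices m I" using assms(2-4) by (auto simp: indices_def)
  then have "A (i # js) \<in> \<real>\<^sub>\<ge>\<^sub>0" using assms(1) by (auto simp: nonneg_tensor_def)
  then show "A (i # js) = complex_of_real (Re (A (i # js)))" "0 \<le> Re (A (i # js))"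
    by (auto simp: complex_nonneg_Reals_iff complex_eq_iff)
qed

lemma tensor_apply_of_real:
  assumes "nonneg_tensor m I A" "2 \<le> m" "i \<in> I"
  shows "tensor_apply m I A (\<lambda>j. complex_of_real (x j)) i = complex_of_real (real_apply m I A x i)"
proof -
  have "prod_list (map (\<lambda>j. complex_of_real (x j)) js) = complex_of_real (prod_list (map x js))" for js
    by (induction js) auto
  then show ?thesis
    unfolding tensor_apply_def real_apply_def of_real_sum
    by (intro sum.cong refl) (metis nonneg_entry(1)[OF assms] of_real_mult)
qed

lemma cmod_tensor_apply_le:
  assumes "nonneg_tensor m I A" "2 \<le> m" "i \<in> I"
  shows "cmod (tensor_apply m I A x i) \<le> real_apply m I A (\<lambda>j. cmod (x j)) i"
proof -
  have prod: "cmod (prod_list (map x js)) = prod_list (map (\<lambda>j. cmod (x j)) js)" for js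
    by (induction js) (auto simp: norm_mult)
  have "cmod (tensor_apply m I A x i)
      \<le> (\<Sum>js\<in>indices (m - 1) I. cmod (A (i # js) * prod_list (map x js)))"
    unfolding tensor_apply_def by (rule norm_sum)
  also have "\<dots> = real_apply m I A (\<lambda>j. cmod (x j)) i"
    unfolding real_apply_def
  proof (rule sum.cong)
    fix js assume "js \<in> indices (m - 1) I"
    from nonneg_entry[OF assms this]
    have "cmod (A (i # js)) = Re (A (i # js))" by (metis norm_of_real abs_of_nonneg)
    then show "cmod (A (i # js) * prod_list (map x js))
        = Re (A (i # js)) * prod_list (map (\<lambda>j. cmod (x j)) js)"
      by (simp add: norm_mult prod)
  qed simp
  finally show ?thesis .
qed

abbreviation links :: "nat \<Rightarrow> 'i set \<Rightarrow> 'i tensor \<Rightarrow> ('i \<times> 'i) set" where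
  "links m I A \<equiv> arcs (tensor_digraph m I A)"

lemma links_iff:
  "(i, j) \<in> links m I A \<longleftrightarrow> i \<in> I \<and> (\<exists>js\<in>indices (m - 1) I. A (i # js) \<noteq> 0 \<and> j \<in> set js)"
  by (simp add: tensor_digraph_def)


section \<open>The Perron vector\<close>

text \<open>
  Weakly irreducible nonnegative tensors, together with the zero tensor of dimension one, so that
  the subtensor on every strongly connected component is an instance.
\<close>
locale connected_tensor =
  fixes m :: nat and I :: "'i set" and A :: "'i tensor"
  assumes order: "2 \<le> m"
    and finite_I: "finite I"
    and nonempty: "I \<noteq> {}"
    and nonneg: "nonneg_tensor m I A"
    and connected: "i \<in> I \<Longrightarrow> j \<in> I \<Longrightarrow> (i, j) \<in> (links m I A)\<^sup>*"
begin

abbreviation "act \<equiv> real_apply m I A"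

lemmas entry = nonneg_entry[OF nonneg order]

lemma entry_pos:
  assumes "i \<in> I" "js \<in> indices (m - 1) I" "A (i # js) \<noteq> 0"
  shows "0 < Re (A (i # js))"
  using entry[OF assms(1,2)] assms(3) by (metis of_real_0 order_le_less)

lemma linkE:
  assumes "(i, j) \<in> links m I A"
  obtains js where "i \<in> I" "js \<in> indices (m - 1) I" "0 < Re (A (i # js))" "j \<in> set js" "j \<in> I"
  using assms entry_pos by (auto simp: links_iff dest: indicesD)

lemma act_nonneg:
  assumes "i \<in> I" "\<And>j. j \<in> I \<Longrightarrow> 0 \<le> x j"
  shows "0 \<le> act x i"
  unfolding real_apply_def
  using assms entry by (intro sum_nonneg mult_nonneg_nonneg prod_list_nonneg) (auto dest: indicesD)

lemma act_mono:
  assumes "i \<in> I" "\<And>j. j \<in> I \<Longrightarrow> 0 \<le> x j \<and> x j \<le> y j"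
  shows "act x i \<le> act y i"
  unfolding real_apply_def
  using assms entry by (intro sum_mono mult_left_mono prod_list_mono) (auto dest: indicesD)

lemma act_strict_mono:
  assumes "(i, j) \<in> links m I A" and xy: "\<And>k. k \<in> I \<Longrightarrow> 0 \<le> x k \<and> x k \<le> y k \<and> 0 < y k"
    and "x j < y j"
  shows "act x i < act y i"
proof -
  obtain js where js: "i \<in> I" "js \<in> indices (m - 1) I" "0 < Re (A (i # js))" "j \<in> set js"
    using assms(1) by (rule linkE)
  have "prod_list (map x js) < prod_list (map y js)"
    using js(2) xy by (intro prod_list_strict_mono[where j = j] js(4) assms(3)) (auto dest: indicesD)
  then have "Re (A (i # js)) * prod_list (map x js) < Re (A (i # js)) * prod_list (map y js)"
    using js(3) by simp
  moreover have "Re (A (i # ks)) * prod_list (map x ks) \<le> Re (A (i # ks)) * prod_list (map y ks)"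
    if "ks \<in> indices (m - 1) I" for ks
    using that xy entry(2)[OF js(1) that]
    by (intro mult_left_mono prod_list_mono) (auto dest: indicesD)
  ultimately show ?thesis
    unfolding real_apply_def
    by (intro sum_strict_mono_ex1 finite_indices finite_I) (use js(2) in auto)
qed

text \<open>
  The positive vectors whose Collatz--Wielandt quotients \<open>act x i / x i ^ (m - 1)\<close> are at most \<open>c\<close>.
  The Perron eigenvalue is the least \<open>c\<close> for which there is one.
\<close>
definition superharmonic :: "real \<Rightarrow> ('i \<Rightarrow> real) \<Rightarrow> bool" where
  "superharmonic c x \<longleftrightarrow> (\<forall>i\<in>I. 0 < x i \<and> act x i \<le> c * x i ^ (m - 1))"

definition perron :: "real \<Rightarrow> ('i \<Rightarrow> real) \<Rightarrow> bool" where
  "perron r y \<longleftrightarrow> 0 \<le> r \<and> (\<forall>i\<in>I. 0 < y i \<and> act y i = r * y i ^ (m - 1))"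

lemma superharmonic_scale:
  assumes "superharmonic c x" "0 < s"
  shows "superharmonic c (\<lambda>j. s * x j)"
  unfolding superharmonic_def
proof (intro ballI conjI)
  fix i assume i: "i \<in> I"
  show "0 < s * x i" using assms i by (simp add: superharmonic_def)
  have "s ^ (m - 1) * act x i \<le> s ^ (m - 1) * (c * x i ^ (m - 1))"
    using assms i by (intro mult_left_mono) (auto simp: superharmonic_def)
  then show "act (\<lambda>j. s * x j) i \<le> c * (s * x i) ^ (m - 1)"
    by (simp add: real_apply_scale power_mult_distrib mult_ac)
qed

text \<open>
  If \<open>(j, k)\<close> is an arc coming from an entry \<open>a\<close>, then \<open>a * x k\<close> is at most \<open>act x j\<close>, because the
  other factors of the corresponding monomial are at least 1, and this is at most
  \<open>c * x j ^ (m - 1)\<close>. A bound on \<open>x j\<close> thus gives one on \<open>x k\<close>.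
\<close>
lemma superharmonic_bounded_along_path:
  assumes "(i, j) \<in> (links m I A)\<^sup>*" "0 \<le> c"
  shows "\<exists>B. \<forall>x. superharmonic c x \<longrightarrow> (\<forall>k\<in>I. 1 \<le> x k) \<longrightarrow> x i = 1 \<longrightarrow> x j \<le> B"
  using assms(1)
proof induction
  case base
  show ?case by (rule exI[of _ 1]) simp
next
  case (step j k)
  obtain B where B: "superharmonic c x \<Longrightarrow> \<forall>k\<in>I. 1 \<le> x k \<Longrightarrow> x i = 1 \<Longrightarrow> x j \<le> B" for x
    using step.IH by blast
  obtain js where js: "j \<in> I" "js \<in> indices (m - 1) I" "0 < Re (A (j # js))" "k \<in> set js" "k \<in> I"
    using step.hyps(2) by (rule linkE)
  have "x k \<le> c * B ^ (m - 1) / Re (A (j # js))"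
    if x: "superharmonic c x" "\<forall>k\<in>I. 1 \<le> x k" "x i = 1" for x
  proof -
    have "x k \<le> prod_list (map x js)"
    proof -
      have "\<forall>l\<in>set js. 1 \<le> x l" using js(2) x(2) by (auto dest: indicesD)
      then show ?thesis using js(4)
      proof (induction js)
        case (Cons l ls)
        have 1: "1 \<le> prod_list (map x ls)" using Cons.prems(1)
        proof (induction ls)
          case (Cons a ls)
          then have "1 * 1 \<le> x a * prod_list (map x ls)" by (intro mult_mono) auto
          then show ?case by simp
        qed simp
        show ?case
        proof (cases "k = l")
          case True
          then have "x k * 1 \<le> x l * prod_list (map x ls)"
            using 1 Cons.prems by (intro mult_mono) auto
          then show ?thesis by simp
        next
          case False
          then have "1 * x k \<le> x l * prod_list (map x ls)"
            using 1 Cons by (intro mult_mono) (auto intro: order_trans[of 0 1])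
          then show ?thesis by simp
        qed
      qed simp
    qed
    then have "Re (A (j # js)) * x k \<le> Re (A (j # js)) * prod_list (map x js)"
      using js(3) by simp
    also have "\<dots> \<le> act x j"
      unfolding real_apply_def
    proof (rule member_le_sum[OF js(2)])
      fix ks assume "ks \<in> indices (m - 1) I - {js}"
      then show "0 \<le> Re (A (j # ks)) * prod_list (map x ks)"
        using entry(2)[OF js(1)] x(2)
        by (intro mult_nonneg_nonneg prod_list_nonneg) (auto dest!: indicesD intro: order_trans[of 0 1])
    qed (rule finite_indices[OF finite_I])
    also have "\<dots> \<le> c * x j ^ (m - 1)" using x(1) js(1) by (simp add: superharmonic_def)
    also have "\<dots> \<le> c * B ^ (m - 1)"
      using B[OF x] x(2) js(1) assms(2)
      by (intro mult_left_mono power_mono) (auto intro: order_trans[of 0 1])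
    finally show ?thesis using js(3) by (simp add: field_simps)
  qed
  then show ?case by blast
qed

lemma superharmonic_normalised_bounded:
  assumes "0 \<le> c"
  shows "\<exists>B. \<forall>x. superharmonic c x \<longrightarrow> (\<forall>k\<in>I. 1 \<le> x k) \<longrightarrow> (\<exists>i\<in>I. x i = 1) \<longrightarrow> (\<forall>j\<in>I. x j \<le> B)"
proof -
  have "\<exists>B. \<forall>i\<in>I. \<forall>j\<in>I. \<forall>x. superharmonic c x \<longrightarrow> (\<forall>k\<in>I. 1 \<le> x k) \<longrightarrow> x i = 1 \<longrightarrow> x j \<le> B i j"
    using superharmonic_bounded_along_path[OF connected assms] by metis
  then obtain B where B: "superharmonic c x \<Longrightarrow> \<forall>k\<in>I. 1 \<le> x k \<Longrightarrow> x i = 1 \<Longrightarrow> x j \<le> B i j"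
    if "i \<in> I" "j \<in> I" for i j x by blast
  let ?B = "Max ((\<lambda>(i, j). B i j) ` (I \<times> I))"
  have "B i j \<le> ?B" if "i \<in> I" "j \<in> I" for i j
    using that finite_I by (intro Max_ge) auto
  then show ?thesis using B by (intro exI[of _ ?B]) (meson order_trans)
qed

lemma superharmonic_value_nonneg:
  assumes "superharmonic c x" shows "0 \<le> c"
proof -
  obtain i where i: "i \<in> I" using nonempty by blast
  have "0 \<le> act x i" using assms by (intro act_nonneg[OF i]) (auto simp: superharmonic_def less_imp_le)
  also have "\<dots> \<le> c * x i ^ (m - 1)" using assms i by (simp add: superharmonic_def)
  finally show ?thesis using assms i by (simp add: superharmonic_def zero_le_mult_iff not_le)
    (metis less_eq_real_def not_less zero_less_power)
qed

text \<open>
  Connectedness replaces the missing compactness of the set of positive vectors: after scaling the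
  least entry to 1, all superharmonic vectors for values up to a fixed \<open>C\<close> lie in one box, so the
  pairs of a vector and a value form a compact set, on which the value attains its minimum.
\<close>
lemma superharmonic_minimal_value:
  "\<exists>r x. superharmonic r x \<and> (\<forall>c z. superharmonic c z \<longrightarrow> r \<le> c)"
proof -
  define C where "C = (\<Sum>i\<in>I. act (\<lambda>_. 1) i)"
  have C: "0 \<le> C" unfolding C_def by (intro sum_nonneg act_nonneg) auto
  have one: "superharmonic C (\<lambda>_. 1)"
    unfolding superharmonic_def C_def
    by (auto intro!: member_le_sum finite_I act_nonneg)
  obtain B where B: "superharmonic C x \<Longrightarrow> \<forall>k\<in>I. 1 \<le> x k \<Longrightarrow> \<exists>i\<in>I. x i = 1 \<Longrightarrow> \<forall>j\<in>I. x j \<le> B" for x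
    using superharmonic_normalised_bounded[OF C] by blast
  define K :: "(('i \<Rightarrow> real) \<times> real) set" where
    "K = (PiE UNIV (\<lambda>i. if i \<in> I then {1..B} else {1}) \<times> {0..C}) \<inter>
         {p. \<forall>i\<in>I. act (fst p) i \<le> snd p * fst p i ^ (m - 1)}"
  have "compact (PiE UNIV (\<lambda>i. if i \<in> I then {1..B} else {1::real}))"
    unfolding compactin_euclidean_iff[symmetric] euclidean_product_topology[symmetric]
    by (subst compactin_PiE) auto
  moreover have "closed {p :: ('i \<Rightarrow> real) \<times> real. \<forall>i\<in>I. act (fst p) i \<le> snd p * fst p i ^ (m - 1)}"
  proof -
    have coord: "continuous_on UNIV (\<lambda>p :: ('i \<Rightarrow> real) \<times> real. fst p i)" for i
      by (rule continuous_on_product_then_coordinatewise) (intro continuous_intros)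
    have "continuous_on UNIV (\<lambda>p :: ('i \<Rightarrow> real) \<times> real. prod_list (map (fst p) js))" for js
      by (induction js) (auto intro!: continuous_intros coord)
    then have "continuous_on UNIV (\<lambda>p :: ('i \<Rightarrow> real) \<times> real. act (fst p) i)" for i
      unfolding real_apply_def by (intro continuous_intros)
    then have "closed (\<Inter>i\<in>I. {p :: ('i \<Rightarrow> real) \<times> real. act (fst p) i \<le> snd p * fst p i ^ (m - 1)})"
      by (intro closed_INT ballI closed_Collect_le continuous_intros coord)
    moreover have "(\<Inter>i\<in>I. {p :: ('i \<Rightarrow> real) \<times> real. act (fst p) i \<le> snd p * fst p i ^ (m - 1)})
        = {p. \<forall>i\<in>I. act (fst p) i \<le> snd p * fst p i ^ (m - 1)}" by auto
    ultimately show ?thesis by simp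
  qed
  ultimately have "compact K"
    unfolding K_def by (intro compact_Int_closed compact_Times) auto
  \<comment> \<open>The coordinates outside \<open>I\<close> do not influence \<open>act\<close>; they are set to 1 so that the box is
    compact in the product topology on all functions.\<close>
  have in_K: "((\<lambda>j. if j \<in> I then z j else 1), c) \<in> K"
    if z: "superharmonic c z" "c \<le> C" "\<forall>k\<in>I. 1 \<le> z k" "\<exists>i\<in>I. z i = 1" for z c
  proof -
    have "superharmonic C z"
      unfolding superharmonic_def
    proof (intro ballI conjI)
      fix i assume i: "i \<in> I"
      show "0 < z i" using z(1) i by (simp add: superharmonic_def)
      then have "c * z i ^ (m - 1) \<le> C * z i ^ (m - 1)" using z(2) by (intro mult_right_mono) auto
      moreover have "act z i \<le> c * z i ^ (m - 1)" using z(1) i by (simp add: superharmonic_def)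
      ultimately show "act z i \<le> C * z i ^ (m - 1)" by (rule order_trans[rotated])
    qed
    then have "\<forall>j\<in>I. z j \<le> B" using B z(3,4) by blast
    moreover have "act (\<lambda>j. if j \<in> I then z j else 1) i = act z i" for i
      unfolding real_apply_def
      by (intro sum.cong refl arg_cong2[of _ _ _ _ "(*)"] arg_cong[of _ _ prod_list] map_cong)
        (auto dest: indicesD)
    ultimately show ?thesis
      using z superharmonic_value_nonneg[OF z(1)] by (auto simp: K_def superharmonic_def)
  qed
  have normalise: "\<exists>z'. superharmonic c z' \<and> (\<forall>k\<in>I. 1 \<le> z' k) \<and> (\<exists>i\<in>I. z' i = 1)"
    if z: "superharmonic c z" for z c
  proof -
    define \<mu> where "\<mu> = Min (z ` I)"
    have "\<mu> \<in> z ` I" unfolding \<mu>_def using finite_I nonempty by (intro Min_in) auto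
    then obtain i where i: "i \<in> I" "z i = \<mu>" by auto
    have le: "\<mu> \<le> z j" if "j \<in> I" for j unfolding \<mu>_def using that finite_I by (intro Min_le) auto
    have pos: "0 < \<mu>" using i z by (metis superharmonic_def)
    then have "\<forall>k\<in>I. 1 \<le> inverse \<mu> * z k" using le by (simp add: field_simps)
    moreover have "\<exists>i\<in>I. inverse \<mu> * z i = 1" using i pos by (intro bexI[of _ i]) auto
    moreover have "superharmonic c (\<lambda>j. inverse \<mu> * z j)"
      using pos by (intro superharmonic_scale[OF z]) simp
    ultimately show ?thesis by blast
  qed
  have "K \<noteq> {}" using in_K[OF one] nonempty by auto
  then obtain p where p: "p \<in> K" "\<And>q. q \<in> K \<Longrightarrow> snd p \<le> snd q"
    using continuous_attains_inf[OF \<open>compact K\<close> _ continuous_on_snd[OF continuous_on_id]] by auto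
  have "1 \<le> fst p i" if "i \<in> I" for i
  proof -
    have "fst p \<in> PiE UNIV (\<lambda>i. if i \<in> I then {1..B} else {1})" using p(1) by (auto simp: K_def)
    then have "fst p i \<in> (if i \<in> I then {1..B} else {1})" by (rule PiE_mem) simp
    then show ?thesis using that by simp
  qed
  then have "superharmonic (snd p) (fst p)"
    using p(1) by (auto simp: K_def superharmonic_def intro: less_le_trans[OF zero_less_one])
  moreover have "snd p \<le> c" if z: "superharmonic c z" for c z
  proof (cases "c \<le> C")
    case True
    obtain z' where z': "superharmonic c z'" "\<forall>k\<in>I. 1 \<le> z' k" "\<exists>i\<in>I. z' i = 1"
      using normalise[OF z] by blast
    from p(2)[OF in_K[OF z'(1) True z'(2,3)]] show ?thesis by simp
  next
    case False
    then show ?thesis using p(1) by (auto simp: K_def)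
  qed
  ultimately show ?thesis by blast
qed

lemma exists_entering_link:
  assumes "S \<subseteq> I" "S \<noteq> {}" "S \<noteq> I"
  shows "\<exists>i\<in>I - S. \<exists>j\<in>S. (i, j) \<in> links m I A"
proof -
  obtain i j where i: "i \<in> I - S" and j: "j \<in> S" using assms by blast
  then have "(i, j) \<in> (links m I A)\<^sup>*" using assms by (intro connected) auto
  then show ?thesis using i j
  proof (induction rule: converse_rtrancl_induct)
    case (step a b)
    then have "b \<in> I" by (auto elim: linkE)
    then show ?case using step by (cases "b \<in> S") auto
  qed simp
qed

text \<open>
  Among the superharmonic vectors for the minimal value \<open>r\<close>, take one with the largest number of
  indices at which the inequality is strict. If it is strict everywhere, \<open>r\<close> is not minimal. If it
  is strict on a proper nonempty subset, some arc \<open>(i, j)\<close> enters this subset; shrinking \<open>x\<close> slightly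
  on the subset keeps the inequality strict there and makes it strict at \<open>i\<close> too, against
  maximality. So there is equality everywhere.
\<close>
theorem perron_vector_exists:
  "\<exists>r y. perron r y"
proof -
  obtain r x0 where x0: "superharmonic r x0" and r_min: "superharmonic c z \<Longrightarrow> r \<le> c" for c z
    using superharmonic_minimal_value by blast
  define strict where "strict x = {i \<in> I. act x i < r * x i ^ (m - 1)}" for x
  have strict_I: "strict x \<subseteq> I" for x by (auto simp: strict_def)
  have "card (strict x) < Suc (card I)" for x
    using card_mono[OF finite_I strict_I] by (simp add: less_Suc_eq_le)
  then obtain x where x: "superharmonic r x"
    and x_max: "superharmonic r z \<Longrightarrow> card (strict z) \<le> card (strict x)" for z
    using ex_has_greatest_nat[of "superharmonic r" x0 "\<lambda>x. card (strict x)" "Suc (card I)"] x0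
    by (meson less_imp_le)
  have x_pos: "0 < x i" if "i \<in> I" for i using x that by (simp add: superharmonic_def)
  have r: "0 \<le> r" by (rule superharmonic_value_nonneg[OF x])
  have "strict x \<noteq> I"
  proof
    assume all: "strict x = I"
    let ?c = "Max ((\<lambda>i. act x i / x i ^ (m - 1)) ` I)"
    have "act x i \<le> ?c * x i ^ (m - 1)" if "i \<in> I" for i
    proof -
      have "act x i / x i ^ (m - 1) \<le> ?c" using that finite_I by (intro Max_ge) auto
      then show ?thesis using x_pos[OF that] by (simp add: pos_divide_le_eq)
    qed
    then have "superharmonic ?c x"
      unfolding superharmonic_def using x_pos by blast
    then have "r \<le> ?c" by (rule r_min)
    moreover have "act x i / x i ^ (m - 1) < r" if "i \<in> I" for i
    proof -
      have "act x i < r * x i ^ (m - 1)" using all that unfolding strict_def by blast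
      then show ?thesis using x_pos[OF that] by (simp add: pos_divide_less_eq)
    qed
    then have "?c < r"
      using finite_I nonempty by simp
    ultimately show False by simp
  qed
  moreover have "strict x = {} \<or> strict x = I"
  proof (rule ccontr)
    assume "\<not> ?thesis"
    then obtain i j where ij: "i \<in> I" "i \<notin> strict x" "j \<in> strict x" "(i, j) \<in> links m I A"
      using exists_entering_link[OF strict_I] by blast
    define z where "z s k = (if k \<in> strict x then s * x k else x k)" for s k
    have "\<forall>\<^sub>F s in at_left 1. act (z s) k < r * z s k ^ (m - 1)" if k: "k \<in> strict x" for k
    proof -
      have coord: "((\<lambda>s. z s l) \<longlongrightarrow> x l) (at_left 1)" for l
        unfolding z_def by (cases "l \<in> strict x") (auto intro!: tendsto_eq_intros)
      have "((\<lambda>s. prod_list (map (z s) js)) \<longlongrightarrow> prod_list (map x js)) (at_left 1)" for js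
        by (induction js) (auto intro!: tendsto_intros coord)
      then have "((\<lambda>s. act (z s) k) \<longlongrightarrow> act x k) (at_left 1)"
        unfolding real_apply_def by (intro tendsto_intros)
      moreover have "((\<lambda>s. r * z s k ^ (m - 1)) \<longlongrightarrow> r * x k ^ (m - 1)) (at_left 1)"
        by (intro tendsto_intros coord)
      ultimately have "((\<lambda>s. r * z s k ^ (m - 1) - act (z s) k) \<longlongrightarrow> r * x k ^ (m - 1) - act x k) (at_left 1)"
        by (intro tendsto_diff)
      from order_tendstoD(1)[OF this, of 0] show ?thesis
        using k by (simp add: strict_def)
    qed
    then have "\<forall>\<^sub>F s in at_left 1. \<forall>k\<in>strict x. act (z s) k < r * z s k ^ (m - 1)"
      by (intro eventually_ball_finite finite_subset[OF strict_I finite_I]) auto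
    moreover have "\<forall>\<^sub>F s in at_left (1 :: real). 0 < s \<and> s < 1"
      using eventually_at_left_real[of 0 "1 :: real"] by simp
    ultimately obtain s where s: "\<forall>k\<in>strict x. act (z s) k < r * z s k ^ (m - 1)" "0 < s" "s < 1"
      using eventually_happens'[OF trivial_limit_at_left_real eventually_conj] by blast
    have z: "0 < z s k \<and> z s k \<le> x k" if "k \<in> I" for k
      using x_pos[OF that] s(2,3) by (auto simp: z_def)
    have outside: "act (z s) k \<le> r * z s k ^ (m - 1)" if "k \<in> I" "k \<notin> strict x" for k
    proof -
      have "act (z s) k \<le> act x k" using z by (intro act_mono that) (auto intro: less_imp_le)
      also have "\<dots> \<le> r * x k ^ (m - 1)" using x that by (simp add: superharmonic_def)
      finally show ?thesis using that by (simp add: z_def)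
    qed
    have "z s j < x j"
      using ij(3) s(3) x_pos strict_I[of x] by (auto simp: z_def)
    have "superharmonic r (z s)"
      using z s(1) outside unfolding superharmonic_def by (meson less_imp_le)
    then have "card (strict (z s)) \<le> card (strict x)" by (rule x_max)
    moreover have "act (z s) i < act x i"
      using z x_pos \<open>z s j < x j\<close>
      by (intro act_strict_mono[OF ij(4)]) (auto intro: less_imp_le)
    then have "i \<in> strict (z s)"
      using x ij(1,2) by (auto simp: strict_def superharmonic_def z_def[of s i])
    then have "insert i (strict x) \<subseteq> strict (z s)"
      using s(1) strict_I by (auto simp: strict_def)
    then have "Suc (card (strict x)) \<le> card (strict (z s))"
      using card_mono[OF finite_subset[OF strict_I finite_I], of "insert i (strict x)" "z s"]
        finite_subset[OF strict_I finite_I, of x] ij(2) by simp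
    ultimately show False by simp
  qed
  ultimately have "strict x = {}" by blast
  then have "act x i = r * x i ^ (m - 1)" if "i \<in> I" for i
    using that x by (force simp: strict_def superharmonic_def)
  then show ?thesis using r x_pos unfolding perron_def by blast
qed

text \<open>
  Let \<open>t * y\<close> be the smallest multiple of the Perron vector that dominates \<open>x\<close>, touching it at an
  index \<open>p\<close>. Monotonicity at \<open>p\<close> gives \<open>\<mu> \<le> r\<close>. If \<open>\<mu> = r\<close>, a link from a touching index to one
  where \<open>x\<close> is strictly below \<open>t * y\<close> would make the inequality strict, so touching spreads along
  the links to all of \<open>I\<close>.
\<close>
lemma subharmonic_comparison:
  assumes perron: "perron r y"
    and x: "\<And>i. i \<in> I \<Longrightarrow> 0 \<le> x i" "\<And>i. i \<in> I \<Longrightarrow> \<mu> * x i ^ (m - 1) \<le> act x i"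
    and nz: "\<exists>i\<in>I. x i \<noteq> 0"
  shows "\<mu> \<le> r \<and> (\<mu> = r \<longrightarrow> (\<exists>t>0. \<forall>i\<in>I. x i = t * y i))"
proof -
  have y: "0 < y i" "act y i = r * y i ^ (m - 1)" if "i \<in> I" for i
    using perron that by (auto simp: perron_def)
  define t where "t = Max ((\<lambda>i. x i / y i) ` I)"
  have le: "x i \<le> t * y i" if "i \<in> I" for i
  proof -
    have "x i / y i \<le> t" unfolding t_def using that finite_I by (intro Max_ge) auto
    then show ?thesis using y(1)[OF that] by (simp add: pos_divide_le_eq)
  qed
  have "t \<in> (\<lambda>i. x i / y i) ` I" unfolding t_def using finite_I nonempty by (intro Max_in) auto
  then obtain p where p: "p \<in> I" "x p = t * y p" using y(1) by fastforce
  obtain q where "q \<in> I" "x q \<noteq> 0" using nz by blast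
  then have "0 < t * y q" using le[of q] x(1)[of q] by linarith
  then have t: "0 < t" using y(1)[OF \<open>q \<in> I\<close>] by (simp add: zero_less_mult_iff)
  have ty: "act (\<lambda>k. t * y k) i = r * (t * y i) ^ (m - 1)" if "i \<in> I" for i
    using y(2)[OF that] by (simp add: real_apply_scale power_mult_distrib)
  have "\<mu> * (t * y p) ^ (m - 1) \<le> act x p" using x(2)[OF p(1)] p(2) by simp
  also have "\<dots> \<le> act (\<lambda>k. t * y k) p" using x(1) le by (intro act_mono p(1)) auto
  also have "\<dots> = r * (t * y p) ^ (m - 1)" by (rule ty[OF p(1)])
  finally have "\<mu> \<le> r" using t y(1)[OF p(1)] by (simp add: mult_le_cancel_right)
  moreover have "x i = t * y i" if \<mu>: "\<mu> = r" and i: "i \<in> I" for i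
    using connected[OF p(1) i]
  proof (induction rule: rtrancl_induct)
    case base
    show ?case by (rule p(2))
  next
    case (step j k)
    then have jk: "j \<in> I" "k \<in> I" by (auto elim: linkE)
    show ?case
    proof (rule ccontr)
      assume "x k \<noteq> t * y k"
      then have "x k < t * y k" using le[OF jk(2)] by simp
      then have "act x j < act (\<lambda>k. t * y k) j"
        using x(1) le y(1) t by (intro act_strict_mono[OF step.hyps(2)]) auto
      then show False using x(2)[OF jk(1)] ty[OF jk(1)] \<mu> step.IH by simp
    qed
  qed
  ultimately show ?thesis using t by blast
qed

end


section \<open>Eigenvectors whose eigenvalue has maximal modulus\<close>

lemma eigen_equation_cong:
  assumes "\<And>i. i \<in> I \<Longrightarrow> x i = z i"
  shows "eigen_equation m I A \<mu> x \<longleftrightarrow> eigen_equation m I A \<mu> z"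
proof -
  have "tensor_apply m I A x i = tensor_apply m I A z i" for i
    unfolding tensor_apply_def
    by (intro sum.cong refl arg_cong2[of _ _ _ _ "(*)"] arg_cong[of _ _ prod_list] map_cong assms)
      (auto dest: indicesD)
  then show ?thesis using assms by (simp add: eigen_equation_def)
qed

lemma eigen_equation_scale:
  assumes "eigen_equation m I A \<mu> x"
  shows "eigen_equation m I A \<mu> (\<lambda>j. c * x j)"
proof -
  have "tensor_apply m I A (\<lambda>j. c * x j) i = c ^ (m - 1) * tensor_apply m I A x i" for i
    unfolding tensor_apply_def sum_distrib_left
    by (rule sum.cong) (auto simp: prod_list_scale indices_def algebra_simps)
  then show ?thesis using assms by (simp add: eigen_equation_def power_mult_distrib)
qed

lemma eigen_equation_zero:
  assumes "2 \<le> m"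
  shows "eigen_equation m I A \<mu> (\<lambda>_. 0)"
proof -
  have "prod_list (map (\<lambda>_. 0) js) = (0 :: complex)" if "js \<in> indices (m - 1) I" for js :: "'a list"
    using that assms by (cases js) (auto simp: indices_def)
  then show ?thesis using assms by (simp add: eigen_equation_def tensor_apply_def)
qed

text \<open>
  The form in which support symmetry is used: it makes the digraph symmetric, and it lets the phase
  condition at the first index of an entry be read off at its other indices.
\<close>
lemma comb_symmetric_exchange:
  assumes sym: "comb_symmetric m I A" and "2 \<le> m" and i: "i \<in> I"
    and js: "js \<in> indices (m - 1) I" "A (i # js) \<noteq> 0" "j \<in> set js"
  obtains ks where "ks \<in> indices (m - 1) I" "A (j # ks) \<noteq> 0" "i \<in> set ks"
    "mset (j # ks) = mset (i # js)"
proof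
  let ?ks = "i # remove1 j js"
  show perm: "mset (j # ?ks) = mset (i # js)" using js(3) by simp
  show ks: "?ks \<in> indices (m - 1) I"
    using i js mset_eq_length[OF perm] mset_eq_setD[OF perm] by (auto simp: indices_def)
  have "i # js \<in> indices m I" "j # ?ks \<in> indices m I"
    using i js ks \<open>2 \<le> m\<close> by (auto simp: indices_def)
  then show "A (j # ?ks) \<noteq> 0" using sym perm js(2) unfolding comb_symmetric_def by metis
qed simp

text \<open>
  The equality case of the triangle inequality: a weighted average of points of a disc lies on the
  bounding circle at \<open>v\<close> only if all points of positive weight are \<open>v\<close>.
\<close>
lemma weighted_average_extremal:
  fixes w :: "'a \<Rightarrow> real" and u :: "'a \<Rightarrow> complex"
  assumes "finite S" and w: "\<And>k. k \<in> S \<Longrightarrow> 0 \<le> w k"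
    and u: "\<And>k. k \<in> S \<Longrightarrow> cmod (u k) \<le> cmod v"
    and eq: "(\<Sum>k\<in>S. complex_of_real (w k) * u k) = complex_of_real (\<Sum>k\<in>S. w k) * v"
    and k: "k \<in> S" "0 < w k"
  shows "u k = v"
proof (cases "v = 0")
  case True
  then show ?thesis using u[OF k(1)] by simp
next
  case False
  define q where "q l = u l / v" for l
  have q: "cmod (q l) \<le> 1" if "l \<in> S" for l
    using u[OF that] False by (simp add: q_def norm_divide)
  have "(\<Sum>l\<in>S. complex_of_real (w l) * q l) = complex_of_real (\<Sum>l\<in>S. w l)"
    using eq False by (simp add: q_def flip: sum_divide_distrib)
  from arg_cong[OF this, of Re] have sum: "(\<Sum>l\<in>S. w l * (1 - Re (q l))) = 0"
    by (simp add: algebra_simps sum_subtractf)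
  have terms: "0 \<le> w l * (1 - Re (q l))" if "l \<in> S" for l
    using w[OF that] q[OF that] complex_Re_le_cmod[of "q l"] by (intro mult_nonneg_nonneg) auto
  have "w k * (1 - Re (q k)) = 0"
    using sum_nonneg_0[where f = "\<lambda>l. w l * (1 - Re (q l))", OF \<open>finite S\<close> terms sum k(1)] .
  then have Re: "Re (q k) = 1" using k(2) by simp
  have "(cmod (q k))\<^sup>2 \<le> 1" using q[OF k(1)] by (simp add: power_le_one)
  then have "(Im (q k))\<^sup>2 \<le> 0" using Re by (simp add: cmod_power2)
  then have "q k = 1" using Re by (simp add: complex_eq_iff)
  then show ?thesis using False by (simp add: q_def)
qed

lemma cmod_prod_list_const:
  assumes "\<And>k. k \<in> set js \<Longrightarrow> cmod (u k) = t"
  shows "cmod (prod_list (map u js)) = t ^ length js"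
  using assms by (induction js) (auto simp: norm_mult)

context connected_tensor
begin

text \<open>
  By the triangle inequality the moduli of an eigenvector form a subharmonic vector, to which the
  comparison with the Perron vector applies.
\<close>
lemma eigenvector_comparison:
  assumes y: "perron r y" and x: "eigen_equation m I A \<mu> x" "\<exists>i\<in>I. x i \<noteq> 0"
  shows "cmod \<mu> \<le> r \<and> (cmod \<mu> = r \<longrightarrow> (\<exists>t>0. \<forall>i\<in>I. cmod (x i) = t * y i))"
proof (rule subharmonic_comparison[OF y])
  fix i assume i: "i \<in> I"
  have "cmod \<mu> * cmod (x i) ^ (m - 1) = cmod (tensor_apply m I A x i)"
    using x(1) i by (simp add: eigen_equation_def norm_mult norm_power)
  also have "\<dots> \<le> act (\<lambda>j. cmod (x j)) i" by (rule cmod_tensor_apply_le[OF nonneg order i])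
  finally show "cmod \<mu> * cmod (x i) ^ (m - 1) \<le> act (\<lambda>j. cmod (x j)) i" .
qed (use x(2) in auto)

lemma perron_eigen_equation:
  assumes "perron r y"
  shows "eigen_equation m I A (complex_of_real r) (\<lambda>j. complex_of_real (y j))"
  using assms by (simp add: eigen_equation_def tensor_apply_of_real[OF nonneg order] perron_def)

lemma spectral_radius_eq:
  assumes y: "perron r y"
  shows "tensor_spectral_radius m I A = r"
  unfolding tensor_spectral_radius_def
proof (rule Greatest_equality)
  let ?x = "\<lambda>j. if j \<in> I then complex_of_real (y j) else 0"
  have "eigen_equation m I A (complex_of_real r) ?x"
    using perron_eigen_equation[OF y] by (subst eigen_equation_cong) auto
  moreover obtain i where "i \<in> I" using nonempty by blast
  then have "?x i \<noteq> 0" using y by (auto simp: perron_def)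
  then have "?x \<noteq> (\<lambda>_. 0)" by metis
  moreover have "?x \<in> cvec I" by (simp add: cvec_def)
  ultimately have "tensor_eigenvalue m I A (complex_of_real r)"
    unfolding tensor_eigenvalue_def by blast
  then show "\<exists>\<mu>. tensor_eigenvalue m I A \<mu> \<and> r = cmod \<mu>"
    using y by (intro exI[of _ "complex_of_real r"]) (auto simp: perron_def)
next
  fix s assume "\<exists>\<mu>. tensor_eigenvalue m I A \<mu> \<and> s = cmod \<mu>"
  then obtain \<mu> x where s: "s = cmod \<mu>" and x: "x \<in> cvec I" "x \<noteq> (\<lambda>_. 0)" "eigen_equation m I A \<mu> x"
    unfolding tensor_eigenvalue_def by blast
  then have "\<exists>i\<in>I. x i \<noteq> 0" by (auto simp: cvec_def fun_eq_iff)
  then show "s \<le> r" using eigenvector_comparison[OF y x(3)] s by blast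
qed

lemma perron_exists: "\<exists>y. perron (tensor_spectral_radius m I A) y"
  using perron_vector_exists spectral_radius_eq by metis

text \<open>
  Writing \<open>x k = y k * u k\<close>, where all \<open>u k\<close> have the same modulus, the eigenvalue equation at \<open>i\<close>
  says that a weighted average of the products of the \<open>u k\<close> over \<open>js\<close> is \<open>u i ^ (m - 1)\<close>, which has
  the modulus of each product. So each product of positive weight equals it.
\<close>
lemma phase_along_edge:
  assumes y: "perron r y" and x: "eigen_equation m I A (complex_of_real r) x" "\<exists>i\<in>I. x i \<noteq> 0"
    and js: "i \<in> I" "js \<in> indices (m - 1) I" "A (i # js) \<noteq> 0"
  shows "prod_list (map (\<lambda>k. x k / y k) (i # js)) = (x i / y i) ^ m"
proof -
  obtain t where t: "0 < t" "\<And>k. k \<in> I \<Longrightarrow> cmod (x k) = t * y k"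
    using eigenvector_comparison[OF y x] y by (auto simp: perron_def)
  define u where "u k = x k / complex_of_real (y k)" for k
  have y_pos: "0 < y k" if "k \<in> I" for k using y that by (simp add: perron_def)
  have xu: "x k = complex_of_real (y k) * u k" if "k \<in> I" for k
    using y_pos[OF that] by (simp add: u_def)
  have u: "cmod (u k) = t" if "k \<in> I" for k
    using t(2)[OF that] y_pos[OF that] by (simp add: u_def norm_divide)
  define w where "w ks = Re (A (i # ks)) * prod_list (map y ks)" for ks
  have "complex_of_real (w ks) * prod_list (map u ks) = A (i # ks) * prod_list (map x ks)"
    if ks: "ks \<in> indices (m - 1) I" for ks
  proof -
    have "set ks \<subseteq> I" using ks by (simp add: indices_def)
    then have "prod_list (map x ks) = complex_of_real (prod_list (map y ks)) * prod_list (map u ks)"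
      by (induction ks) (auto simp: xu)
    then show ?thesis using entry(1)[OF js(1) ks] by (simp add: w_def)
  qed
  then have "(\<Sum>ks\<in>indices (m - 1) I. complex_of_real (w ks) * prod_list (map u ks))
      = tensor_apply m I A x i"
    unfolding tensor_apply_def by (intro sum.cong) auto
  also have "\<dots> = complex_of_real r * x i ^ (m - 1)" using x(1) js(1) by (simp add: eigen_equation_def)
  also have "\<dots> = complex_of_real (r * y i ^ (m - 1)) * u i ^ (m - 1)"
    by (simp add: xu[OF js(1)] power_mult_distrib)
  also have "r * y i ^ (m - 1) = (\<Sum>ks\<in>indices (m - 1) I. w ks)"
    using y js(1) by (simp add: perron_def real_apply_def w_def)
  finally have sum: "(\<Sum>ks\<in>indices (m - 1) I. complex_of_real (w ks) * prod_list (map u ks))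
      = complex_of_real (\<Sum>ks\<in>indices (m - 1) I. w ks) * u i ^ (m - 1)" .
  have "prod_list (map u js) = u i ^ (m - 1)"
  proof (rule weighted_average_extremal[OF _ _ _ sum js(2)])
    show "finite (indices (m - 1) I)" by (rule finite_indices[OF finite_I])
    show "0 < w js"
      unfolding w_def using entry_pos[OF js] js(2) y_pos
      by (intro mult_pos_pos prod_list_pos) (auto dest: indicesD)
    fix ks assume ks: "ks \<in> indices (m - 1) I"
    show "0 \<le> w ks"
      unfolding w_def using entry(2)[OF js(1) ks] ks y_pos
      by (intro mult_nonneg_nonneg prod_list_nonneg) (auto dest: indicesD intro: less_imp_le)
    have "cmod (prod_list (map u ks)) = t ^ (m - 1)"
      using ks u by (subst cmod_prod_list_const[of _ _ t]) (auto simp: indices_def)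
    then show "cmod (prod_list (map u ks)) \<le> cmod (u i ^ (m - 1))"
      using u[OF js(1)] by (simp add: norm_power)
  qed
  moreover have "u i ^ m = u i * u i ^ (m - 1)" using order by (simp add: power_eq_if)
  ultimately show ?thesis by (simp flip: u_def)
qed

text \<open>
  The product over all indices of a nonzero entry does not depend on their order, so all its indices
  have the same \<open>m\<close>-th power of the phase; connectedness carries this to all of \<open>I\<close>.
\<close>
lemma phase_power_constant:
  assumes sym: "comb_symmetric m I A"
    and y: "perron r y" and x: "eigen_equation m I A (complex_of_real r) x" "\<exists>i\<in>I. x i \<noteq> 0"
    and ij: "i \<in> I" "j \<in> I"
  shows "(x i / y i) ^ m = (x j / y j) ^ m"
  using connected[OF ij]
proof (induction rule: rtrancl_induct)
  case (step j k)
  obtain js where js: "j \<in> I" "js \<in> indices (m - 1) I" "A (j # js) \<noteq> 0" "k \<in> set js" "k \<in> I"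
    using step.hyps(2) by (metis linkE less_irrefl zero_complex.simps(1))
  from comb_symmetric_exchange[OF sym order js(1-4)]
  obtain ks where ks: "ks \<in> indices (m - 1) I" "A (k # ks) \<noteq> 0" and perm: "mset (k # ks) = mset (j # js)"
    by blast
  have "(x k / y k) ^ m = prod_list (map (\<lambda>l. x l / y l) (k # ks))"
   by (rule phase_along_edge[OF y x js(5) ks, symmetric])
  also have "\<dots> = prod_list (map (\<lambda>l. x l / y l) (j # js))"
    unfolding prod_mset_prod_list[symmetric] mset_map perm ..
  also have "\<dots> = (x j / y j) ^ m" by (rule phase_along_edge[OF y x js(1-3)])
  finally show ?case using step.IH by simp
qed simp

lemma spectral_radius_pos:
  assumes "nonzero_tensor m I A"
  shows "0 < tensor_spectral_radius m I A"
proof -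
  obtain y where y: "perron (tensor_spectral_radius m I A) y" using perron_exists by blast
  obtain "is" where "is": "is \<in> indices m I" "A is \<noteq> 0" using assms by (auto simp: nonzero_tensor_def)
  then obtain i js where i: "is = i # js" "i \<in> I" and js: "js \<in> indices (m - 1) I"
    using order by (cases "is") (auto simp: indices_def)
  have "0 < Re (A (i # js)) * prod_list (map y js)"
    using entry_pos[OF i(2) js] "is"(2) i(1) y js
    by (intro mult_pos_pos prod_list_pos) (auto simp: perron_def dest: indicesD)
  also have "\<dots> \<le> act y i"
    unfolding real_apply_def
  proof (rule member_le_sum[OF js])
    fix ks assume "ks \<in> indices (m - 1) I - {js}"
    then show "0 \<le> Re (A (i # ks)) * prod_list (map y ks)"
      using entry(2)[OF i(2)] y
      by (intro mult_nonneg_nonneg prod_list_nonneg) (auto simp: perron_def dest!: indicesD intro: less_imp_le)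
  qed (rule finite_indices[OF finite_I])
  also have "\<dots> = tensor_spectral_radius m I A * y i ^ (m - 1)" using y i(2) by (simp add: perron_def)
  finally show ?thesis using y i(2) by (simp add: perron_def zero_less_mult_iff)
qed

end


section \<open>Positive dimension in the Zariski topology\<close>

text \<open>
  The point \<open>[p]\<close> is cut out by the \<open>2 \<times> 2\<close> minors \<open>p i * X j - p j * X i\<close>.
\<close>
lemma zariski_closed_point:
  assumes P: "P \<in> proj_space I"
  shows "zariski_closed I {P}"
proof -
  obtain p where p: "p \<in> P" using proj_point_nonempty[OF P] by blast
  define f :: "'a \<Rightarrow> 'a \<Rightarrow> 'a cpoly" where
    "f i j = Poly_Mapping.single (Poly_Mapping.single j 1) (p i)
           + Poly_Mapping.single (Poly_Mapping.single i 1) (- p j)" for i j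
  have f_eval: "cpoly_eval (f i j) x = p i * x j - p j * x i" for i j x
    by (simp add: f_def cpoly_eval_add cpoly_eval_single monom_eval_def)
  let ?S = "{f i j | i j. i \<in> I \<and> j \<in> I}"
  have "homogeneous I 1 (f i j)" if "i \<in> I" "j \<in> I" for i j
    unfolding homogeneous_def
  proof
    fix e assume "e \<in> Poly_Mapping.keys (f i j)"
    then have "e = Poly_Mapping.single j 1 \<or> e = Poly_Mapping.single i 1"
      using keys_add[of "Poly_Mapping.single (Poly_Mapping.single j 1) (p i)"
          "Poly_Mapping.single (Poly_Mapping.single i 1) (- p j)"]
      by (auto simp: f_def simp del: One_nat_def split: if_splits)
    then show "Poly_Mapping.keys e \<subseteq> I \<and> (\<Sum>i\<in>Poly_Mapping.keys e. Poly_Mapping.lookup e i) = 1"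
      using that by auto
  qed
  moreover have "zero_locus I ?S = {P}"
  proof
    show "{P} \<subseteq> zero_locus I ?S"
    proof -
      have "p i * x j = p j * x i" if x: "x \<in> P" for x i j
      proof -
        obtain c where "x = (\<lambda>i. c * p i)" using proj_point_scale[OF P p x] by metis
        then show ?thesis by simp
      qed
      then show ?thesis using P by (auto simp: zero_locus_def f_eval)
    qed
    show "zero_locus I ?S \<subseteq> {P}"
    proof
      fix Q assume Q: "Q \<in> zero_locus I ?S"
      then have QI: "Q \<in> proj_space I" by (simp add: zero_locus_def)
      obtain x where x: "x \<in> Q" using proj_point_nonempty[OF QI] by blast
      have proportional: "p i * x j = p j * x i" if "i \<in> I" "j \<in> I" for i j
      proof -
        have "cpoly_eval (f i j) x = 0" using Q x that unfolding zero_locus_def by blast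
        then show ?thesis by (simp add: f_eval)
      qed
      have px: "p \<in> cvec I" "p \<noteq> (\<lambda>_. 0)" "x \<in> cvec I" "x \<noteq> (\<lambda>_. 0)"
        using P p QI x in_quotient_imp_subset[OF equiv_proj_rel] unfolding proj_space_def by blast+
      obtain i where i: "i \<in> I" "p i \<noteq> 0" using px(1,2) by (auto simp: cvec_def fun_eq_iff)
      have x_eq: "x = (\<lambda>j. x i / p i * p j)"
      proof
        fix j show "x j = x i / p i * p j"
        proof (cases "j \<in> I")
          case True
          then show ?thesis using proportional[OF i(1) True] i(2) by (simp add: field_simps)
        next
          case False
          then show ?thesis using px(1,3) by (simp add: cvec_def)
        qed
      qed
      have "x i / p i \<noteq> 0"
      proof
        assume "x i / p i = 0"
        with x_eq have "x = (\<lambda>_. 0)" by (simp add: fun_eq_iff)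
        then show False using px(4) by simp
      qed
      then have "(p, x) \<in> proj_rel I"
        using px x_eq unfolding proj_rel_def by (auto intro!: exI[of _ "x i / p i"])
      then have "P = Q"
        using quotient_eqI[OF equiv_proj_rel] P QI p x unfolding proj_space_def by metis
      then show "Q \<in> {P}" by simp
    qed
  qed
  ultimately show ?thesis unfolding zariski_closed_def by (intro exI[of _ ?S]) blast
qed

lemma t1_space_zariski: "t1_space (zariski I)"
  by (simp add: t1_space_closedin_singleton closedin_zariski zariski_closed_point)

text \<open>
  In a finite \<open>T\<^sub>1\<close> space all subsets are closed, so an irreducible set \<open>Z\<close> cannot be split into
  \<open>{p}\<close> and \<open>Z - {p}\<close> and has just one point. Hence there is no chain of length one.
\<close>
lemma krull_dim_finite:
  assumes "t1_space X" "finite (topspace X)"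
  shows "\<not> krull_dim X > 0"
proof
  assume "krull_dim X > 0"
  then obtain k Z where k: "0 < k" and Z: "\<forall>i\<le>k. closedin X (Z i) \<and> irreducible_in X (Z i)"
    "\<forall>i<k. Z i \<subset> Z (Suc i)"
    unfolding krull_dim_def less_Sup_iff by (auto simp: zero_ereal_def)
  have Z0: "Z 0 \<noteq> {}" "Z 0 \<subset> Z 1" and Z1: "irreducible_in X (Z 1)"
    using Z k by (auto simp: irreducible_in_def Suc_le_eq)
  obtain p q where p: "p \<in> Z 0" and q: "q \<in> Z 1 - Z 0" using Z0 by blast
  have sub: "Z 1 \<subseteq> topspace X" using Z1 by (simp add: irreducible_in_def)
  have "closedin X F" if "F \<subseteq> Z 1" for F
    using assms that sub by (meson t1_space_closedin_finite finite_subset order_trans)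
  then have "closedin X {p}" "closedin X (Z 1 - {p})" using p Z0 by auto
  moreover have "Z 1 \<subseteq> {p} \<union> (Z 1 - {p})" by blast
  ultimately have "Z 1 \<subseteq> {p} \<or> Z 1 \<subseteq> Z 1 - {p}"
    using Z1 unfolding irreducible_in_def by blast
  then show False using p q Z0 by blast
qed

text \<open>
  The closure of an irreducible set is irreducible, so a point of \<open>L\<close> and the closure of \<open>L\<close> form a
  chain.
\<close>
lemma krull_dim_pos:
  assumes t1: "t1_space X" and L: "irreducible_in X L" and pq: "p \<in> L" "q \<in> L" "p \<noteq> q"
  shows "krull_dim X > 0"
proof -
  define Z where "Z i = (if i = 0 then {p} else X closure_of L)" for i :: nat
  have sub: "L \<subseteq> topspace X" using L by (simp add: irreducible_in_def)
  have cl: "L \<subseteq> X closure_of L" by (rule closure_of_subset[OF sub])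
  have "irreducible_in X {p}" using pq(1) sub by (auto simp: irreducible_in_def)
  moreover have "irreducible_in X (X closure_of L)"
    unfolding irreducible_in_def
  proof (intro conjI allI impI)
    show "X closure_of L \<noteq> {}" using cl pq(1) by blast
    fix C D assume CD: "closedin X C \<and> closedin X D \<and> X closure_of L \<subseteq> C \<union> D"
    then have "L \<subseteq> C \<or> L \<subseteq> D" using L cl unfolding irreducible_in_def by blast
    then show "X closure_of L \<subseteq> C \<or> X closure_of L \<subseteq> D"
      using CD closure_of_minimal by metis
  qed (rule closure_of_subset_topspace)
  moreover have "closedin X {p}" using t1 pq(1) sub by (auto simp: t1_space_closedin_singleton)
  moreover have "{p} \<subset> X closure_of L" using pq cl by auto
  ultimately have "(\<forall>i\<le>1. closedin X (Z i) \<and> irreducible_in X (Z i)) \<and> (\<forall>i<1. Z i \<subset> Z (Suc i))"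
    by (auto simp: Z_def)
  then have "ereal (real 1) \<le> krull_dim X"
    unfolding krull_dim_def by (intro Sup_upper) blast
  then show ?thesis by (simp add: order_less_le_trans[of 0 1] flip: one_ereal_def)
qed

lemma cpoly_eval_on_line: "\<exists>h. \<forall>t. poly h t = cpoly_eval f (\<lambda>i. x i + t * y i)"
proof -
  have "\<forall>t. poly (\<Sum>e\<in>Poly_Mapping.keys f. smult (Poly_Mapping.lookup f e)
          (\<Prod>i\<in>Poly_Mapping.keys e. [:x i, y i:] ^ Poly_Mapping.lookup e i)) t
      = cpoly_eval f (\<lambda>i. x i + t * y i)"
    by (simp add: cpoly_eval_def monom_eval_def poly_sum poly_prod)
  then show ?thesis by blast
qed

text \<open>
  A homogeneous polynomial restricts to a polynomial in \<open>t\<close>. A closed set that does not contain the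
  line thus meets it in finitely many parameters, and two such sets cannot cover it, as there are
  infinitely many. The affine part of the line suffices, since irreducibility is not affected by
  taking closures.
\<close>
lemma line_irreducible:
  assumes x: "x \<in> cvec I" and y: "y \<in> cvec I"
    and nz: "\<And>t. (\<lambda>i. x i + t * y i) \<noteq> (\<lambda>_. 0)"
    and V: "range (\<lambda>t. proj_rel I `` {\<lambda>i. x i + t * y i}) \<subseteq> V" "V \<subseteq> proj_space I"
  shows "irreducible_in (subtopology (zariski I) V) (range (\<lambda>t. proj_rel I `` {\<lambda>i. x i + t * y i}))"
proof -
  define pt where "pt t = (\<lambda>i. x i + t * y i)" for t
  define L where "L t = proj_rel I `` {pt t}" for t
  have pt: "pt t \<in> cvec I - {\<lambda>_. 0}" for t
    using x y nz by (auto simp: pt_def cvec_def)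
  have mem: "pt t \<in> L t" for t
    using pt equiv_class_self[OF equiv_proj_rel] by (auto simp: L_def)
  have proper: "finite {t. L t \<in> C}" if C: "zariski_closed I C" "\<not> range L \<subseteq> C" for C
  proof -
    obtain S where S: "\<forall>f\<in>S. \<exists>d. homogeneous I d f" "C = zero_locus I S"
      using C(1) by (auto simp: zariski_closed_def)
    obtain t0 where "L t0 \<notin> C" using C(2) by blast
    moreover have "L t0 \<in> proj_space I"
      using pt unfolding L_def proj_space_def by (intro quotientI)
    ultimately obtain z f where z: "z \<in> L t0" "f \<in> S" "cpoly_eval f z \<noteq> 0"
      unfolding S(2) zero_locus_def by blast
    obtain c where c: "c \<noteq> 0" "z = (\<lambda>i. c * pt t0 i)"
      using proj_point_scale[OF \<open>L t0 \<in> proj_space I\<close> mem z(1)] .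
    obtain d where "homogeneous I d f" using S(1) z(2) by blast
    then have f0: "cpoly_eval f (pt t0) \<noteq> 0" using z(3) by (auto simp: c(2) cpoly_eval_scale)
    obtain h where h: "poly h t = cpoly_eval f (pt t)" for t
      using cpoly_eval_on_line unfolding pt_def by metis
    have "h \<noteq> 0" using f0 h[of t0] by auto
    then have "finite {t. poly h t = 0}" by (rule poly_roots_finite)
    moreover have "{t. L t \<in> C} \<subseteq> {t. poly h t = 0}"
      using mem z(2) by (auto simp: S(2) zero_locus_def h)
    ultimately show ?thesis by (rule finite_subset[rotated])
  qed
  have "irreducible_in (subtopology (zariski I) V) (range L)"
    unfolding irreducible_in_def
  proof (intro conjI allI impI)
    show "range L \<subseteq> topspace (subtopology (zariski I) V)"
      using V by (auto simp: L_def pt_def)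
    fix C D
    assume CD: "closedin (subtopology (zariski I) V) C \<and> closedin (subtopology (zariski I) V) D
      \<and> range L \<subseteq> C \<union> D"
    then obtain C' D' where C': "zariski_closed I C'" "C = C' \<inter> V"
      and D': "zariski_closed I D'" "D = D' \<inter> V"
      unfolding closedin_subtopology closedin_zariski by blast
    show "range L \<subseteq> C \<or> range L \<subseteq> D"
    proof (rule ccontr)
      assume "\<not> ?thesis"
      moreover have "range L \<subseteq> V" using V(1) by (simp add: L_def pt_def)
      ultimately have "\<not> range L \<subseteq> C'" "\<not> range L \<subseteq> D'" using C'(2) D'(2) by blast+
      then have "finite ({t. L t \<in> C'} \<union> {t. L t \<in> D'})" using proper C'(1) D'(1) by blast
      moreover have "{t. L t \<in> C'} \<union> {t. L t \<in> D'} = UNIV" using CD C'(2) D'(2) by blast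
      ultimately show False using infinite_UNIV_char_0[where ?'a = complex] by simp
    qed
  qed auto
  then show ?thesis by (simp add: L_def pt_def)
qed


section \<open>Decomposition into components\<close>

text \<open>
  The hypotheses on the whole tensor. The strongly connected components of its digraph, those with
  zero subtensor included, are called blocks.
\<close>
locale symmetric_tensor =
  fixes m :: nat and I :: "'i set" and A :: "'i tensor"
  assumes order: "2 \<le> m"
    and finite_I: "finite I"
    and nonneg: "nonneg_tensor m I A"
    and sym: "comb_symmetric m I A"
begin

abbreviation "blocks \<equiv> pre_digraph.sccs_verts (tensor_digraph m I A)"

lemma links_sym: "sym (links m I A)"
proof (rule symI)
  fix i j assume "(i, j) \<in> links m I A"
  then obtain js where js: "i \<in> I" "js \<in> indices (m - 1) I" "A (i # js) \<noteq> 0" "j \<in> set js"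
    by (auto simp: links_iff)
  moreover have "j \<in> I" using js by (auto dest: indicesD)
  ultimately show "(j, i) \<in> links m I A"
    using comb_symmetric_exchange[OF sym order js] by (auto simp: links_iff)
qed

lemma links_subset: "links m I A \<subseteq> I \<times> I"
  by (auto simp: links_iff dest: indicesD)

lemma reachable_iff:
  "reachable (tensor_digraph m I A) i j \<longleftrightarrow> i \<in> I \<and> (i, j) \<in> (links m I A)\<^sup>*"
proof -
  have ends: "arcs_ends (tensor_digraph m I A) = links m I A" "verts (tensor_digraph m I A) = I"
    by (auto simp: arcs_ends_def arc_to_ends_def tensor_digraph_def)
  have "i \<in> I \<and> (i, j) \<in> (links m I A)\<^sup>*" if "(i, j) \<in> rtrancl_on I (links m I A)"
    using that by (induction rule: rtrancl_on_induct) auto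
  moreover have "(i, j) \<in> rtrancl_on I (links m I A)" if "i \<in> I" "(i, j) \<in> (links m I A)\<^sup>*"
    using that(2,1) by (induction rule: rtrancl_induct)
      (use links_subset in \<open>auto intro: rtrancl_on_into_rtrancl_on\<close>)
  ultimately show ?thesis unfolding reachable_def ends by blast
qed

lemma rtrancl_links_subset: "i \<in> I \<Longrightarrow> (i, j) \<in> (links m I A)\<^sup>* \<Longrightarrow> j \<in> I"
  using links_subset by (auto elim: rtranclE)

text \<open>
  Arcs are two-way, so whatever is reachable from an index lies in its strongly connected component.
\<close>
lemma block_iff: "\<alpha> \<in> blocks \<longleftrightarrow> (\<exists>i\<in>I. \<alpha> = {j. (i, j) \<in> (links m I A)\<^sup>*})"
proof -
  have sym_rtrancl: "(j, i) \<in> (links m I A)\<^sup>*" if "(i, j) \<in> (links m I A)\<^sup>*" for i j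
    using that sym_rtrancl[OF links_sym] by (blast dest: symD)
  have reach_sym: "reachable (tensor_digraph m I A) i j \<longleftrightarrow> reachable (tensor_digraph m I A) j i" for i j
    unfolding reachable_iff using sym_rtrancl rtrancl_links_subset by blast
  show ?thesis
  proof
    assume \<alpha>: "\<alpha> \<in> blocks"
    then obtain i where i: "i \<in> \<alpha>" by (auto simp: pre_digraph.sccs_verts_def)
    then have "reachable (tensor_digraph m I A) i j \<longleftrightarrow> j \<in> \<alpha>" for j
      using \<alpha> reach_sym unfolding pre_digraph.sccs_verts_def by blast
    then show "\<exists>i\<in>I. \<alpha> = {j. (i, j) \<in> (links m I A)\<^sup>*}"
      using i unfolding reachable_iff by blast
  next
    assume "\<exists>i\<in>I. \<alpha> = {j. (i, j) \<in> (links m I A)\<^sup>*}"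
    then obtain i where "i \<in> I" "\<alpha> = {j. (i, j) \<in> (links m I A)\<^sup>*}" by blast
    then show "\<alpha> \<in> blocks"
      unfolding pre_digraph.sccs_verts_def reachable_iff
      using sym_rtrancl rtrancl_links_subset by (auto intro: rtrancl_trans)
  qed
qed

lemma block_subset: "\<alpha> \<in> blocks \<Longrightarrow> \<alpha> \<subseteq> I"
  using rtrancl_links_subset by (auto simp: block_iff)

lemma block_nonempty: "\<alpha> \<in> blocks \<Longrightarrow> \<alpha> \<noteq> {}"
  by (auto simp: block_iff)

lemma finite_blocks: "finite blocks"
  by (rule finite_subset[of _ "Pow I"]) (use block_subset finite_I in auto)

lemma ex_block: "i \<in> I \<Longrightarrow> \<exists>\<alpha>\<in>blocks. i \<in> \<alpha>"
  by (rule bexI[of _ "{j. (i, j) \<in> (links m I A)\<^sup>*}"]) (auto simp: block_iff)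

lemma block_disjoint: "\<alpha> \<in> blocks \<Longrightarrow> \<beta> \<in> blocks \<Longrightarrow> \<alpha> \<noteq> \<beta> \<Longrightarrow> \<alpha> \<inter> \<beta> = {}"
  unfolding pre_digraph.sccs_verts_def by blast

lemma block_closed:
  assumes "\<alpha> \<in> blocks" "i \<in> \<alpha>" "js \<in> indices (m - 1) I" "A (i # js) \<noteq> 0"
  shows "set js \<subseteq> \<alpha>"
proof
  fix j assume "j \<in> set js"
  then have "(i, j) \<in> links m I A"
    using assms block_subset by (auto simp: links_iff)
  then show "j \<in> \<alpha>" using assms(1,2) by (auto simp: block_iff)
qed

lemma block_connected_tensor:
  assumes \<alpha>: "\<alpha> \<in> blocks"
  shows "connected_tensor m \<alpha> A"
proof
  show "2 \<le> m" by (rule order)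
  show "finite \<alpha>" using block_subset[OF \<alpha>] finite_I by (rule finite_subset)
  show "\<alpha> \<noteq> {}" by (rule block_nonempty[OF \<alpha>])
  show "nonneg_tensor m \<alpha> A"
    using nonneg block_subset[OF \<alpha>] by (auto simp: nonneg_tensor_def indices_def)
  fix i j assume ij: "i \<in> \<alpha>" "j \<in> \<alpha>"
  have "(i, j) \<in> (links m I A)\<^sup>*"
    using ij \<alpha> sym_rtrancl[OF links_sym] unfolding block_iff
    by (auto intro: rtrancl_trans dest: symD)
  then have "j \<in> \<alpha> \<and> (i, j) \<in> (links m \<alpha> A)\<^sup>*"
  proof (induction rule: rtrancl_induct)
    case (step j k)
    then obtain js where js: "js \<in> indices (m - 1) I" "A (j # js) \<noteq> 0" "k \<in> set js"
      by (auto simp: links_iff)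
    then have "set js \<subseteq> \<alpha>" using block_closed[OF \<alpha>] step.IH by blast
    then have "(j, k) \<in> links m \<alpha> A" "k \<in> \<alpha>"
      using js step.IH by (auto simp: links_iff indices_def)
    then show ?case using step.IH by (auto intro: rtrancl_into_rtrancl)
  qed (use ij in simp)
  then show "(i, j) \<in> (links m \<alpha> A)\<^sup>*" ..
qed

lemma block_comb_symmetric: "\<alpha> \<in> blocks \<Longrightarrow> comb_symmetric m \<alpha> A"
  using sym block_subset unfolding comb_symmetric_def indices_def by blast

text \<open>
  A nonzero entry that starts in a component stays in it, so the other index tuples contribute
  nothing.
\<close>
lemma tensor_apply_component:
  assumes \<alpha>: "\<alpha> \<in> blocks" "i \<in> \<alpha>"
  shows "tensor_apply m I A x i = tensor_apply m \<alpha> A x i"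
  unfolding tensor_apply_def
proof (rule sum.mono_neutral_right)
  show "finite (indices (m - 1) I)" by (rule finite_indices[OF finite_I])
  show "indices (m - 1) \<alpha> \<subseteq> indices (m - 1) I"
    using block_subset[OF \<alpha>(1)] by (auto simp: indices_def)
  show "\<forall>js\<in>indices (m - 1) I - indices (m - 1) \<alpha>. A (i # js) * prod_list (map x js) = 0"
    using block_closed[OF \<alpha>] by (fastforce simp: indices_def)
qed

lemma eigen_equation_blocks:
  "eigen_equation m I A \<mu> x \<longleftrightarrow> (\<forall>\<alpha>\<in>blocks. eigen_equation m \<alpha> A \<mu> x)"
proof
  assume "eigen_equation m I A \<mu> x"
  then show "\<forall>\<alpha>\<in>blocks. eigen_equation m \<alpha> A \<mu> x"
    using block_subset by (auto simp: eigen_equation_def tensor_apply_component[symmetric])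
next
  assume *: "\<forall>\<alpha>\<in>blocks. eigen_equation m \<alpha> A \<mu> x"
  show "eigen_equation m I A \<mu> x"
    unfolding eigen_equation_def
  proof
    fix i assume "i \<in> I"
    then obtain \<alpha> where "\<alpha> \<in> blocks" "i \<in> \<alpha>" using ex_block by blast
    then show "tensor_apply m I A x i = \<mu> * x i ^ (m - 1)"
      using * by (simp add: eigen_equation_def tensor_apply_component)
  qed
qed

lemma eigen_equation_extend:
  assumes \<alpha>: "\<alpha> \<in> blocks" and x: "eigen_equation m \<alpha> A \<mu> x"
  shows "eigen_equation m I A \<mu> (\<lambda>i. if i \<in> \<alpha> then x i else 0)"
  unfolding eigen_equation_blocks
proof
  fix \<beta> assume \<beta>: "\<beta> \<in> blocks"
  show "eigen_equation m \<beta> A \<mu> (\<lambda>i. if i \<in> \<alpha> then x i else 0)"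
  proof (cases "\<beta> = \<alpha>")
    case True
    then show ?thesis
      using x eigen_equation_cong[of \<beta> "\<lambda>i. if i \<in> \<alpha> then x i else 0" x] by simp
  next
    case False
    then have "i \<notin> \<alpha>" if "i \<in> \<beta>" for i using block_disjoint[OF \<alpha> \<beta>] that by blast
    then show ?thesis
      using eigen_equation_zero[OF order] eigen_equation_cong[of \<beta> "\<lambda>i. if i \<in> \<alpha> then x i else 0" "\<lambda>_. 0"]
      by simp
  qed
qed

abbreviation "\<rho> \<equiv> \<lambda>\<alpha>. tensor_spectral_radius m \<alpha> A"

lemma block_perron:
  assumes "\<alpha> \<in> blocks"
  obtains y where "connected_tensor.perron m \<alpha> A (\<rho> \<alpha>) y" "\<And>i. i \<in> \<alpha> \<Longrightarrow> 0 < y i" "0 \<le> \<rho> \<alpha>"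
    "eigen_equation m \<alpha> A (complex_of_real (\<rho> \<alpha>)) (\<lambda>i. complex_of_real (y i))"
proof -
  interpret connected_tensor m \<alpha> A by (rule block_connected_tensor[OF assms])
  obtain y where y: "perron (\<rho> \<alpha>) y" using perron_exists by blast
  show thesis by (rule that[OF y]) (use y perron_eigen_equation in \<open>auto simp: perron_def\<close>)
qed

lemma block_eigenvalue_le:
  assumes "\<alpha> \<in> blocks" "eigen_equation m \<alpha> A \<mu> x" "\<exists>i\<in>\<alpha>. x i \<noteq> 0"
  shows "cmod \<mu> \<le> \<rho> \<alpha>"
proof -
  interpret connected_tensor m \<alpha> A by (rule block_connected_tensor[OF assms(1)])
  show ?thesis using perron_exists eigenvector_comparison assms(2,3) by blast
qed

text \<open>
  The Perron vector of the component with the largest value extends by zero to an eigenvector of \<open>A\<close>.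
  Conversely an eigenvector of \<open>A\<close> is nonzero on some component and restricts to an eigenvector there.
\<close>
lemma spectral_radius_eq_Max:
  assumes "I \<noteq> {}"
  shows "\<rho> I = Max (\<rho> ` blocks)"
  unfolding tensor_spectral_radius_def[of m I]
proof (rule Greatest_equality)
  have "blocks \<noteq> {}" using assms ex_block by blast
  then have "Max (\<rho> ` blocks) \<in> \<rho> ` blocks" using finite_blocks by (intro Max_in) auto
  then obtain \<alpha> where \<alpha>: "\<alpha> \<in> blocks" "Max (\<rho> ` blocks) = \<rho> \<alpha>" by auto
  obtain y where y: "\<And>i. i \<in> \<alpha> \<Longrightarrow> 0 < y i" "0 \<le> \<rho> \<alpha>"
    "eigen_equation m \<alpha> A (complex_of_real (\<rho> \<alpha>)) (\<lambda>i. complex_of_real (y i))"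
    using block_perron[OF \<alpha>(1)] by blast
  let ?x = "\<lambda>i. if i \<in> \<alpha> then complex_of_real (y i) else 0"
  have "eigen_equation m I A (complex_of_real (\<rho> \<alpha>)) ?x"
    by (rule eigen_equation_extend[OF \<alpha>(1) y(3)])
  moreover obtain i where i: "i \<in> \<alpha>" using block_nonempty[OF \<alpha>(1)] by blast
  then have "?x i \<noteq> 0" using y(1)[OF i] by simp
  then have "?x \<noteq> (\<lambda>_. 0)" by metis
  moreover have "?x \<in> cvec I" using block_subset[OF \<alpha>(1)] by (auto simp: cvec_def)
  ultimately have "tensor_eigenvalue m I A (complex_of_real (\<rho> \<alpha>))"
    unfolding tensor_eigenvalue_def by blast
  then show "\<exists>\<mu>. tensor_eigenvalue m I A \<mu> \<and> Max (\<rho> ` blocks) = cmod \<mu>"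
    using \<alpha>(2) y(2) by (intro exI[of _ "complex_of_real (\<rho> \<alpha>)"]) simp
next
  fix s assume "\<exists>\<mu>. tensor_eigenvalue m I A \<mu> \<and> s = cmod \<mu>"
  then obtain \<mu> x where s: "s = cmod \<mu>" and x: "x \<in> cvec I" "x \<noteq> (\<lambda>_. 0)" "eigen_equation m I A \<mu> x"
    unfolding tensor_eigenvalue_def by blast
  obtain i where i: "i \<in> I" "x i \<noteq> 0" using x(1,2) by (auto simp: cvec_def fun_eq_iff)
  then obtain \<alpha> where \<alpha>: "\<alpha> \<in> blocks" "i \<in> \<alpha>" using ex_block by blast
  then have "s \<le> \<rho> \<alpha>"
    using block_eigenvalue_le x(3) i(2) unfolding s eigen_equation_blocks by blast
  also have "\<dots> \<le> Max (\<rho> ` blocks)" using \<alpha>(1) finite_blocks by (intro Max_ge) auto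
  finally show "s \<le> Max (\<rho> ` blocks)" .
qed

lemma spectral_radius_pos:
  assumes "nonzero_tensor m I A"
  shows "0 < \<rho> I"
proof -
  obtain "is" where "is": "is \<in> indices m I" "A is \<noteq> 0" using assms by (auto simp: nonzero_tensor_def)
  then obtain i js where i: "is = i # js" "i \<in> I" and js: "js \<in> indices (m - 1) I"
    using order by (cases "is") (auto simp: indices_def)
  then obtain \<alpha> where \<alpha>: "\<alpha> \<in> blocks" "i \<in> \<alpha>" using ex_block by blast
  have "set js \<subseteq> \<alpha>" using block_closed[OF \<alpha> js] "is"(2) i(1) by simp
  then have "is \<in> indices m \<alpha>"
    using "is"(1) i(1) \<alpha>(2) by (simp add: indices_def)
  then have "nonzero_tensor m \<alpha> A"
    using "is"(2) unfolding nonzero_tensor_def by blast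
  then have "0 < \<rho> \<alpha>"
    by (rule connected_tensor.spectral_radius_pos[OF block_connected_tensor[OF \<alpha>(1)]])
  also have "\<dots> \<le> \<rho> I"
    using \<alpha>(1) finite_blocks i(2) by (subst spectral_radius_eq_Max) (auto intro: Max_ge)
  finally show ?thesis .
qed

text \<open>
  The components with zero subtensor have spectral radius 0, which is less than that of \<open>A\<close>. So the
  restriction to nonzero subtensors in the definition of weakly irreducible components does not
  change which components attain the spectral radius.
\<close>
lemma extremal_blocks:
  assumes "nonzero_tensor m I A"
  shows "{\<alpha> \<in> weakly_irreducible_components m I A. \<rho> \<alpha> = \<rho> I} = {\<alpha> \<in> blocks. \<rho> \<alpha> = \<rho> I}"
proof -
  have "nonzero_tensor m \<alpha> A" if \<alpha>: "\<alpha> \<in> blocks" "\<rho> \<alpha> = \<rho> I" for \<alpha>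
  proof (rule ccontr)
    assume "\<not> nonzero_tensor m \<alpha> A"
    then have zero: "A (i # js) = 0" if "i \<in> \<alpha>" "js \<in> indices (m - 1) \<alpha>" for i js
      using that order by (auto simp: nonzero_tensor_def indices_def)
    obtain y where y: "\<And>i. i \<in> \<alpha> \<Longrightarrow> 0 < y i"
      "eigen_equation m \<alpha> A (complex_of_real (\<rho> \<alpha>)) (\<lambda>i. complex_of_real (y i))"
      using block_perron[OF \<alpha>(1)] by blast
    obtain i where i: "i \<in> \<alpha>" using block_nonempty[OF \<alpha>(1)] by blast
    have "tensor_apply m \<alpha> A (\<lambda>i. complex_of_real (y i)) i = 0"
      unfolding tensor_apply_def by (rule sum.neutral) (simp add: zero[OF i])
    moreover have "tensor_apply m \<alpha> A (\<lambda>i. complex_of_real (y i)) i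
        = complex_of_real (\<rho> \<alpha>) * complex_of_real (y i) ^ (m - 1)"
      using y(2) i unfolding eigen_equation_def by (rule bspec)
    ultimately have "\<rho> \<alpha> = 0" using y(1)[OF i] by simp
    then show False using \<alpha>(2) spectral_radius_pos[OF assms] by simp
  qed
  then show ?thesis by (auto simp: weakly_irreducible_components_def)
qed


section \<open>The eigenvariety of the spectral radius\<close>

abbreviation "V \<equiv> eigenvariety m I A (complex_of_real (\<rho> I))"

lemma in_eigenvarietyE:
  assumes "P \<in> V"
  obtains x where "P = proj_rel I `` {x}" "x \<in> cvec I" "x \<noteq> (\<lambda>_. 0)"
    "eigen_equation m I A (complex_of_real (\<rho> I)) x"
proof -
  have "P \<in> proj_space I" using assms by (simp add: eigenvariety_def)
  then obtain x where x: "P = proj_rel I `` {x}" "x \<in> cvec I - {\<lambda>_. 0}"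
    unfolding proj_space_def by (auto elim: quotientE)
  then have "x \<in> P" using equiv_class_self[OF equiv_proj_rel] by blast
  then show thesis using assms x that by (auto simp: eigenvariety_def)
qed

lemma in_eigenvarietyI:
  assumes x: "x \<in> cvec I" "x \<noteq> (\<lambda>_. 0)" "eigen_equation m I A (complex_of_real (\<rho> I)) x"
  shows "proj_rel I `` {x} \<in> V"
  unfolding eigenvariety_def
proof (intro CollectI conjI ballI)
  show "proj_rel I `` {x} \<in> proj_space I" unfolding proj_space_def using x by (intro quotientI) simp
  fix z assume "z \<in> proj_rel I `` {x}"
  then obtain c where "z = (\<lambda>i. c * x i)" by (auto simp: proj_rel_def)
  then show "eigen_equation m I A (complex_of_real (\<rho> I)) z"
    using eigen_equation_scale[OF x(3)] by simp
qed

lemma eigenvector_vanishes: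
  assumes x: "eigen_equation m I A (complex_of_real (\<rho> I)) x"
    and \<alpha>: "\<alpha> \<in> blocks" "\<rho> \<alpha> \<noteq> \<rho> I" and i: "i \<in> \<alpha>"
  shows "x i = 0"
proof (rule ccontr)
  assume "x i \<noteq> 0"
  then have "cmod (complex_of_real (\<rho> I)) \<le> \<rho> \<alpha>"
    using x \<alpha>(1) i unfolding eigen_equation_blocks by (intro block_eigenvalue_le) auto
  moreover have "\<rho> \<alpha> \<le> \<rho> I"
    using \<alpha>(1) finite_blocks i block_subset[OF \<alpha>(1)]
    by (subst spectral_radius_eq_Max) (auto intro: Max_ge)
  ultimately show False using \<alpha>(2) by auto
qed

text \<open>
  An eigenvector is supported on \<open>\<alpha>\<close>. Scaled so that it agrees with the Perron vector at the index
  \<open>i0\<close>, it is the Perron vector multiplied entrywise by \<open>m\<close>-th roots of unity, since the \<open>m\<close>-th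
  powers of the phases agree on \<open>\<alpha>\<close>.
\<close>
lemma finite_eigenvariety:
  assumes \<alpha>: "\<alpha> \<in> blocks" and unique: "\<And>\<beta>. \<beta> \<in> blocks \<Longrightarrow> \<rho> \<beta> = \<rho> I \<Longrightarrow> \<beta> = \<alpha>"
    and radius: "\<rho> \<alpha> = \<rho> I"
  shows "finite V"
proof -
  interpret \<alpha>: connected_tensor m \<alpha> A by (rule block_connected_tensor[OF \<alpha>])
  obtain y where y: "\<alpha>.perron (\<rho> I) y" "\<And>i. i \<in> \<alpha> \<Longrightarrow> 0 < y i"
    using block_perron[OF \<alpha>] radius by metis
  obtain i0 where i0: "i0 \<in> \<alpha>" using block_nonempty[OF \<alpha>] by blast
  define \<Omega> :: "('i \<Rightarrow> complex) set" where "\<Omega> = PiE \<alpha> (\<lambda>_. {z. z ^ m = 1})"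
  define vec where "vec \<omega> = (\<lambda>i. if i \<in> \<alpha> then complex_of_real (y i) * \<omega> i else 0)" for \<omega>
  have "V \<subseteq> (\<lambda>\<omega>. proj_rel I `` {vec \<omega>}) ` \<Omega>"
  proof
    fix P assume "P \<in> V"
    then obtain x where P: "P = proj_rel I `` {x}" and x: "x \<in> cvec I" "x \<noteq> (\<lambda>_. 0)"
      "eigen_equation m I A (complex_of_real (\<rho> I)) x"
      by (rule in_eigenvarietyE)
    have off: "x i = 0" if "i \<notin> \<alpha>" for i
    proof (cases "i \<in> I")
      case True
      then obtain \<beta> where \<beta>: "\<beta> \<in> blocks" "i \<in> \<beta>" using ex_block by blast
      then have "\<rho> \<beta> \<noteq> \<rho> I" using unique that by blast
      then show ?thesis by (intro eigenvector_vanishes[OF x(3) \<beta>(1) _ \<beta>(2)])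
    next
      case False
      then show ?thesis using x(1) by (simp add: cvec_def)
    qed
    have eq: "eigen_equation m \<alpha> A (complex_of_real (\<rho> I)) x"
      using x(3) \<alpha> by (simp add: eigen_equation_blocks)
    have nz: "\<exists>i\<in>\<alpha>. x i \<noteq> 0" using off x(2) by (auto simp: fun_eq_iff)
    obtain t where t: "0 < t" "\<forall>i\<in>\<alpha>. cmod (x i) = t * y i"
      using \<alpha>.eigenvector_comparison[OF y(1) eq nz] y(1) by (auto simp: \<alpha>.perron_def)
    define c where "c = x i0 / y i0"
    define \<omega> where "\<omega> = restrict (\<lambda>i. x i / y i / c) \<alpha>"
    have "cmod (x i0) \<noteq> 0" using t y(2)[OF i0] i0 by simp
    then have c: "c \<noteq> 0" using y(2)[OF i0] by (simp add: c_def)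
    have "(x i / y i / c) ^ m = 1" if "i \<in> \<alpha>" for i
    proof -
      have "(x i / y i) ^ m = c ^ m"
        unfolding c_def
        by (rule \<alpha>.phase_power_constant[OF block_comb_symmetric[OF \<alpha>] y(1) eq nz that i0])
      then show ?thesis using c unfolding power_divide[of _ c] by simp
    qed
    then have "\<omega> \<in> \<Omega>" by (auto simp: \<omega>_def \<Omega>_def)
    moreover have x_eq: "x = (\<lambda>i. c * vec \<omega> i)"
    proof
      fix i show "x i = c * vec \<omega> i"
      proof (cases "i \<in> \<alpha>")
        case True
        then show ?thesis using c y(2)[OF True] by (simp add: vec_def \<omega>_def)
      next
        case False
        then show ?thesis using off by (simp add: vec_def)
      qed
    qed
    have "vec \<omega> \<in> cvec I" using block_subset[OF \<alpha>] by (auto simp: vec_def cvec_def)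
    moreover have "vec \<omega> \<noteq> (\<lambda>_. 0)" using x(2) x_eq by auto
    ultimately have "(vec \<omega>, x) \<in> proj_rel I"
      using x(1,2) x_eq c unfolding proj_rel_def by blast
    then have "P = proj_rel I `` {vec \<omega>}"
      unfolding P using equiv_class_eq[OF equiv_proj_rel] by metis
    then show "P \<in> (\<lambda>\<omega>. proj_rel I `` {vec \<omega>}) ` \<Omega>" using \<open>\<omega> \<in> \<Omega>\<close> by blast
  qed
  moreover have "finite \<Omega>"
    unfolding \<Omega>_def using order by (intro finite_PiE \<alpha>.finite_I finite_roots_unity) auto
  ultimately show ?thesis by (blast intro: finite_subset finite_imageI)
qed

text \<open>
  Each component sees only one of the two Perron vectors, up to a scalar, so every combination
  \<open>u + t * v\<close> is an eigenvector. It is never zero, because \<open>u\<close> alone determines it on \<open>\<alpha>\<close>.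
\<close>
lemma eigenvariety_dim_pos:
  assumes \<alpha>: "\<alpha> \<in> blocks" "\<rho> \<alpha> = \<rho> I" and \<beta>: "\<beta> \<in> blocks" "\<rho> \<beta> = \<rho> I"
    and neq: "\<alpha> \<noteq> \<beta>"
  shows "eigenvariety_dim m I A (complex_of_real (\<rho> I)) > 0"
proof -
  obtain y where y: "\<And>i. i \<in> \<alpha> \<Longrightarrow> 0 < y i"
    "eigen_equation m \<alpha> A (complex_of_real (\<rho> I)) (\<lambda>i. complex_of_real (y i))"
    using block_perron[OF \<alpha>(1)] \<alpha>(2) by metis
  obtain z where z: "\<And>i. i \<in> \<beta> \<Longrightarrow> 0 < z i"
    "eigen_equation m \<beta> A (complex_of_real (\<rho> I)) (\<lambda>i. complex_of_real (z i))"
    using block_perron[OF \<beta>(1)] \<beta>(2) by metis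
  have disj: "\<alpha> \<inter> \<beta> = {}" by (rule block_disjoint[OF \<alpha>(1) \<beta>(1) neq])
  define u where "u = (\<lambda>i. if i \<in> \<alpha> then complex_of_real (y i) else 0)"
  define v where "v = (\<lambda>i. if i \<in> \<beta> then complex_of_real (z i) else 0)"
  have u: "eigen_equation m I A (complex_of_real (\<rho> I)) u"
    unfolding u_def by (rule eigen_equation_extend[OF \<alpha>(1) y(2)])
  have v: "eigen_equation m I A (complex_of_real (\<rho> I)) (\<lambda>i. t * v i)" for t
    unfolding v_def by (rule eigen_equation_scale[OF eigen_equation_extend[OF \<beta>(1) z(2)]])
  have uv: "eigen_equation m I A (complex_of_real (\<rho> I)) (\<lambda>i. u i + t * v i)" for t
    unfolding eigen_equation_blocks
  proof
    fix \<gamma> assume \<gamma>: "\<gamma> \<in> blocks"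
    show "eigen_equation m \<gamma> A (complex_of_real (\<rho> I)) (\<lambda>i. u i + t * v i)"
    proof (cases "\<gamma> = \<beta>")
      case True
      then have eq: "u i + t * v i = t * v i" if "i \<in> \<gamma>" for i
        using disj that by (auto simp: u_def)
      have "eigen_equation m \<gamma> A (complex_of_real (\<rho> I)) (\<lambda>i. t * v i)"
        using v[of t] \<gamma> unfolding eigen_equation_blocks by (rule bspec)
      then show ?thesis
        using eigen_equation_cong[of \<gamma> "\<lambda>i. u i + t * v i" "\<lambda>i. t * v i"] eq by blast
    next
      case False
      then have "\<gamma> \<inter> \<beta> = {}" by (rule block_disjoint[OF \<gamma> \<beta>(1)])
      then have eq: "u i + t * v i = u i" if "i \<in> \<gamma>" for i
        using that by (auto simp: v_def)
      have "eigen_equation m \<gamma> A (complex_of_real (\<rho> I)) u"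
        using u \<gamma> unfolding eigen_equation_blocks by (rule bspec)
      then show ?thesis
        using eigen_equation_cong[of \<gamma> "\<lambda>i. u i + t * v i" u] eq by blast
    qed
  qed
  obtain i j where i: "i \<in> \<alpha>" "i \<notin> \<beta>" and j: "j \<in> \<beta>" "j \<notin> \<alpha>"
    using block_nonempty \<alpha>(1) \<beta>(1) disj by blast
  have ui: "u i \<noteq> 0" "v i = 0" using y(1)[OF i(1)] i by (auto simp: u_def v_def)
  have vj: "v j \<noteq> 0" "u j = 0" using z(1)[OF j(1)] j by (auto simp: u_def v_def)
  have cvec: "u \<in> cvec I" "v \<in> cvec I"
    using block_subset \<alpha>(1) \<beta>(1) by (auto simp: u_def v_def cvec_def)
  then have cvec_uv: "(\<lambda>i. u i + t * v i) \<in> cvec I" for t by (simp add: cvec_def)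
  have nz: "(\<lambda>i. u i + t * v i) \<noteq> (\<lambda>_. 0)" for t using ui by (auto simp: fun_eq_iff intro: exI[of _ i])
  define L where "L t = proj_rel I `` {\<lambda>i. u i + t * v i}" for t
  have "range L \<subseteq> V"
    unfolding L_def using in_eigenvarietyI[OF cvec_uv nz uv] by blast
  moreover have "V \<subseteq> proj_space I" by (auto simp: eigenvariety_def)
  ultimately have "irreducible_in (subtopology (zariski I) V) (range L)"
    unfolding L_def by (intro line_irreducible cvec nz)
  moreover have "L 0 \<noteq> L 1"
  proof
    assume "L 0 = L 1"
    then have "(\<lambda>i. u i + 0 * v i, \<lambda>i. u i + 1 * v i) \<in> proj_rel I"
      unfolding L_def using eq_equiv_class[OF _ equiv_proj_rel] cvec_uv nz by blast
    then obtain c where "(\<lambda>i. u i + 1 * v i) = (\<lambda>i. c * (u i + 0 * v i))"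
      by (auto simp: proj_rel_def)
    from fun_cong[OF this, of j] show False using vj by simp
  qed
  ultimately show ?thesis
    unfolding eigenvariety_dim_def
    by (intro krull_dim_pos[where p = "L 0" and q = "L 1"] t1_space_subtopology t1_space_zariski) auto
qed

theorem eigenvariety_dim_pos_iff:
  assumes "nonzero_tensor m I A"
  shows "eigenvariety_dim m I A (complex_of_real (\<rho> I)) > 0 \<longleftrightarrow>
    2 \<le> card {\<alpha> \<in> weakly_irreducible_components m I A. \<rho> \<alpha> = \<rho> I}"
proof -
  define X where "X = {\<alpha> \<in> blocks. \<rho> \<alpha> = \<rho> I}"
  have fin: "finite X" unfolding X_def using finite_blocks by simp
  have "I \<noteq> {}" using assms order by (auto simp: nonzero_tensor_def indices_def)
  have "X \<noteq> {}"
  proof -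
    have "blocks \<noteq> {}" using \<open>I \<noteq> {}\<close> ex_block by blast
    then have "\<rho> I \<in> \<rho> ` blocks"
      unfolding spectral_radius_eq_Max[OF \<open>I \<noteq> {}\<close>] using finite_blocks by (intro Max_in) auto
    then show ?thesis by (auto simp: X_def)
  qed
  have "eigenvariety_dim m I A (complex_of_real (\<rho> I)) > 0 \<longleftrightarrow> 2 \<le> card X"
  proof
    assume pos: "eigenvariety_dim m I A (complex_of_real (\<rho> I)) > 0"
    show "2 \<le> card X"
    proof (rule ccontr)
      assume "\<not> 2 \<le> card X"
      moreover have "card X \<noteq> 0" using \<open>X \<noteq> {}\<close> fin by simp
      ultimately have "card X = 1" by linarith
      then obtain \<alpha> where "X = {\<alpha>}" by (rule card_1_singletonE)
      then have "finite V"
        by (intro finite_eigenvariety[of \<alpha>]) (auto simp: X_def)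
      then have "\<not> krull_dim (subtopology (zariski I) V) > 0"
        by (intro krull_dim_finite t1_space_subtopology t1_space_zariski) simp
      then show False using pos by (simp add: eigenvariety_dim_def)
    qed
  next
    assume "2 \<le> card X"
    then have "\<not> is_singleton X" "\<not> card X \<le> Suc 0" by (auto simp: is_singleton_altdef)
    then obtain \<alpha> \<beta> where "\<alpha> \<in> X" "\<beta> \<in> X" "\<alpha> \<noteq> \<beta>"
      using fin by (auto simp: card_le_Suc0_iff_eq)
    then show "eigenvariety_dim m I A (complex_of_real (\<rho> I)) > 0"
      unfolding X_def by (blast intro: eigenvariety_dim_pos)
  qed
  then show ?thesis unfolding extremal_blocks[OF assms] X_def .
qed

end

theorem theorem5p2:
  fixes m n :: nat and A :: "nat tensor"
  assumes "m \<ge> 2" and "n \<ge> 1"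
    and "nonzero_tensor m {1..n} A"
    and "nonneg_tensor m {1..n} A"
    and "comb_symmetric m {1..n} A"
  shows "eigenvariety_dim m {1..n} A (complex_of_real (tensor_spectral_radius m {1..n} A)) > 0 \<longleftrightarrow>
    card {\<alpha> \<in> weakly_irreducible_components m {1..n} A.
      tensor_spectral_radius m \<alpha> A = tensor_spectral_radius m {1..n} A} \<ge> 2"
proof -
  interpret symmetric_tensor m "{1..n}" A by standard (use assms in auto)
  show ?thesis by (rule eigenvariety_dim_pos_iff[OF assms(3)])
qed

end
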